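(* Let $T>0$, let $\mathcal{U}\subset\mathbb{R}^3$ be an open set containing $0$, let $\varepsilon_*>0$, let $U:\mathbb{R}\times\mathcal{U}\times[0,\varepsilon_*]\to\mathbb{R}$ be a $C^\infty$-function that is $T$-periodic in $t$, and let $\varepsilon\in[0,\varepsilon_*]$. Let $u:\mathbb{R}\to\mathcal{U}$ be a generalized $T$-periodic solution of $$\ddot u=-\frac{u}{|u|^3}+\varepsilon\nabla_uU(t,u,\varepsilon).$$ Then there exist a solution $X(s)=(z(s),w(s),\bar t(s),\tau(s))$, $s\in\mathbb{R}$, of the Hamiltonian system $(\mathcal{M},\omega,K_\varepsilon)$, a lift $t:\mathbb{R}\to\mathbb{R}$ of $\bar t(s)$ which is a homeomorphism, a number $S>0$ and an element $g\in S^1$ such that, for all $s\in\mathbb{R}$, $$K_\varepsilon(X(s))=0,\qquad BL(X(s))=0,\qquad X(s+S)=g\ast X(s),\qquad t(s+S)=t(s)+T,$$ and, denoting by $s=s(t)$ the inverse of $t=t(s)$, $$u(t)=\overline{z(s(t))}\,i\,z(s(t))\qquad\text{for all }t\in\mathbb{R}.$$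
   Context: Generalized solutions. A generalized $T$-periodic solution of the equation is a continuous $T$-periodic function $u:\mathbb{R}\to\mathbb{R}^3$ (with values in $\mathcal{U}$) such that: (1) $\mathcal{Z}=\{t\in\mathbb{R}:u(t)=0\}$ is discrete; (2) for every open interval $I\subset\mathbb{R}\setminus\mathcal{Z}$, $u\in C^\infty(I,\mathbb{R}^3)$ and $u$ satisfies the equation on $I$; (3) for every $t_0\in\mathcal{Z}$ the (two-sided) limits $\lim_{t\to t_0}\frac{u(t)}{|u(t)|}$ and $\lim_{t\to t_0}\bigl(\frac12|\dot u(t)|^2-\frac1{|u(t)|}\bigr)$ exist. Quaternions. $\mathbb{H}$ is the skew-field of quaternions $z=z_0+z_1i+z_2j+z_3k$, $\bar z$ is the conjugate, $\Re(z)=z_0$, and $\mathbb{R}^3$ is identified with the purely imaginary quaternions $\mathbb{IH}=\{z\in\mathbb{H}:\Re(z)=0\}$ by $u=u_1i+u_2j+u_3k$. For $z\in\mathbb{H}$ one has $\bar z i z\in\mathbb{IH}$. The circle $S^1=\{g\in\mathbb{C}:|g|=1\}$ is viewed inside $\mathbb{H}$ via $a+bi$. Regularized system. Let $\mathbb{T}=\mathbb{R}/T\mathbb{Z}$, with $\bar t$ the class of $t\in\mathbb{R}$, and let $\mathcal{M}=\mathbb{H}\times\mathbb{H}\times\mathbb{T}\times\mathbb{R}$ with points $(z,w,\bar t,\tau)$ and symplectic form $\omega=\sum_{l=0}^3dz_l\wedge dw_l+dt\wedge d\tau$. The Hamiltonian is $$K_\varepsilon(z,w,\bar t,\tau)=\frac{|w|^2}{8}+\tau|z|^2-1-\varepsilon|z|^2U(t,\bar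 z i z,\varepsilon),$$ defined on the open subset of $\mathcal{M}$ where $\bar z i z\in\mathcal{U}$. Solutions of the Hamiltonian system $(\mathcal{M},\omega,K_\varepsilon)$ are solutions, in this open subset, of $z_l'=\partial K_\varepsilon/\partial w_l$, $w_l'=-\partial K_\varepsilon/\partial z_l$ ($l=0,\dots,3$), $t'=\partial K_\varepsilon/\partial\tau$, $\tau'=-\partial K_\varepsilon/\partial t$, where $'=d/ds$. The group $S^1$ acts by $g\ast(z,w,\bar t,\tau)=(gz,gw,\bar t,\tau)$, with moment map $BL(z,w,\bar t,\tau)=\Re(\bar z i w)$. *)

theory Defs
  imports "HOL-Analysis.Analysis"
begin

section \<open>Smooth functions on sets\<close>

text \<open>
  Iterated Frechet differentiability relative to \<open>S\<close>; at boundary points this means one-sided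
  derivatives.  The definition is meant for sets on which the derivative \<open>at x within S\<close> is unique,
  such as open sets or \<open>UNIV \<times> V \<times> {0..e}\<close> with \<open>V\<close> open and \<open>e > 0\<close>.
\<close>

primrec Ck_on ::
  "nat \<Rightarrow> 'a::euclidean_space set \<Rightarrow> ('a \<Rightarrow> 'b::real_normed_vector) \<Rightarrow> bool"
where
  "Ck_on 0 S f \<longleftrightarrow> continuous_on S f"
| "Ck_on (Suc k) S f \<longleftrightarrow>
     (\<exists>f'. (\<forall>x\<in>S. (f has_derivative f' x) (at x within S)) \<and> (\<forall>v. Ck_on k S (\<lambda>x. f' x v)))"

definition smooth_on :: "'a::euclidean_space set \<Rightarrow> ('a \<Rightarrow> 'b::real_normed_vector) \<Rightarrow> bool"
  where "smooth_on S f \<longleftrightarrow> (\<forall>k. Ck_on k S f)"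

definition gradient :: "('a::real_inner \<Rightarrow> real) \<Rightarrow> 'a \<Rightarrow> 'a"
  where "gradient f x = (THE d. GDERIV f x :> d)"


section \<open>Generalized periodic solutions of the perturbed Kepler problem\<close>

text \<open>The arguments of \<open>U\<close> are, in this order, time, position and the parameter.\<close>

definition kepler_field ::
  "(real \<Rightarrow> real^3 \<Rightarrow> real \<Rightarrow> real) \<Rightarrow> real \<Rightarrow> real \<Rightarrow> real^3 \<Rightarrow> real^3"
where
  "kepler_field U \<epsilon> t x = - (x /\<^sub>R norm x ^ 3) + \<epsilon> *\<^sub>R gradient (\<lambda>y. U t y \<epsilon>) x"

definition velocity :: "(real \<Rightarrow> real^3) \<Rightarrow> real \<Rightarrow> real^3"
  where "velocity u t = vector_derivative u (at t)"

definition collisions :: "(real \<Rightarrow> real^3) \<Rightarrow> real set"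
  where "collisions u = {t. u t = 0}"

definition generalized_periodic_solution ::
  "real \<Rightarrow> (real^3) set \<Rightarrow> (real \<Rightarrow> real^3 \<Rightarrow> real \<Rightarrow> real) \<Rightarrow> real \<Rightarrow> (real \<Rightarrow> real^3) \<Rightarrow> bool"
where
  "generalized_periodic_solution T \<U> U \<epsilon> u \<longleftrightarrow>
     continuous_on UNIV u \<and> (\<forall>t. u (t + T) = u t) \<and> (\<forall>t. u t \<in> \<U>) \<and>
     discrete (collisions u) \<and>
     (\<forall>I. open I \<and> is_interval I \<and> I \<subseteq> - collisions u \<longrightarrow>
        smooth_on I u \<and>
        (\<forall>t\<in>I. (velocity u has_vector_derivative kepler_field U \<epsilon> t (u t)) (at t))) \<and>
     (\<forall>t0\<in>collisions u.
        (\<exists>l. ((\<lambda>t. u t /\<^sub>R norm (u t)) \<longlongrightarrow> l) (at t0)) \<and>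
        (\<exists>e. ((\<lambda>t. (norm (velocity u t))\<^sup>2 / 2 - 1 / norm (u t)) \<longlongrightarrow> e) (at t0)))"


section \<open>Quaternions\<close>

text \<open>
  Quaternions are vectors in \<open>real^4\<close> (so norm and topology are the Euclidean ones), with
  \<open>z $ 0, z $ 1, z $ 2, z $ 3\<close> the coefficients of \<open>1, i, j, k\<close>; note that \<open>0 = 4\<close> in the index
  type \<open>4\<close>.  The library product \<open>*\<close> on \<open>real^4\<close> is componentwise and is not used.
\<close>

type_synonym quat = "real^4"

definition quat :: "real \<Rightarrow> real \<Rightarrow> real \<Rightarrow> real \<Rightarrow> quat" where
  "quat a b c d = (\<chi> l. if l = 0 then a else if l = 1 then b else if l = 2 then c else d)"

definition qmult :: "quat \<Rightarrow> quat \<Rightarrow> quat"  (infixl \<open>\<odot>\<close> 70) where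
  "p \<odot> q = quat
     (p $ 0 * q $ 0 - p $ 1 * q $ 1 - p $ 2 * q $ 2 - p $ 3 * q $ 3)
     (p $ 0 * q $ 1 + p $ 1 * q $ 0 + p $ 2 * q $ 3 - p $ 3 * q $ 2)
     (p $ 0 * q $ 2 - p $ 1 * q $ 3 + p $ 2 * q $ 0 + p $ 3 * q $ 1)
     (p $ 0 * q $ 3 + p $ 1 * q $ 2 - p $ 2 * q $ 1 + p $ 3 * q $ 0)"

definition qcnj :: "quat \<Rightarrow> quat"
  where "qcnj z = quat (z $ 0) (- z $ 1) (- z $ 2) (- z $ 3)"

definition qRe :: "quat \<Rightarrow> real"
  where "qRe z = z $ 0"

abbreviation qi :: quat where "qi \<equiv> quat 0 1 0 0"

definition quat_of_complex :: "complex \<Rightarrow> quat"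
  where "quat_of_complex g = quat (Re g) (Im g) 0 0"

definition quat_of_R3 :: "real^3 \<Rightarrow> quat"
  where "quat_of_R3 u = quat 0 (u $ 1) (u $ 2) (u $ 3)"

definition R3_of_quat :: "quat \<Rightarrow> real^3"
  where "R3_of_quat z = vector [z $ 1, z $ 2, z $ 3]"

lemma quat_nth [simp]:
  "quat a b c d $ 0 = a" "quat a b c d $ 1 = b" "quat a b c d $ 2 = c" "quat a b c d $ 3 = d"
  by (simp_all add: quat_def)

lemma forall_quat_index: "(\<forall>l::4. P l) \<longleftrightarrow> P 0 \<and> P 1 \<and> P 2 \<and> P 3"
proof -
  have "(4::4) = 0" by simp
  then have "P 4 = P 0" by (rule arg_cong)
  then show ?thesis unfolding forall_4 by metis
qed

lemma quat_eq_iff: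
  "(p::quat) = q \<longleftrightarrow> p $ 0 = q $ 0 \<and> p $ 1 = q $ 1 \<and> p $ 2 = q $ 2 \<and> p $ 3 = q $ 3"
  by (simp add: vec_eq_iff forall_quat_index)

lemma quat_units:
  "qi \<odot> qi = quat (-1) 0 0 0"
  "quat 0 0 1 0 \<odot> quat 0 0 1 0 = quat (-1) 0 0 0"
  "quat 0 0 0 1 \<odot> quat 0 0 0 1 = quat (-1) 0 0 0"
  "qi \<odot> quat 0 0 1 0 = quat 0 0 0 1" "quat 0 0 1 0 \<odot> qi = quat 0 0 0 (-1)"
  "quat 0 0 1 0 \<odot> quat 0 0 0 1 = qi" "quat 0 0 0 1 \<odot> quat 0 0 1 0 = quat 0 (-1) 0 0"
  "quat 0 0 0 1 \<odot> qi = quat 0 0 1 0" "qi \<odot> quat 0 0 0 1 = quat 0 0 (-1) 0"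
  by (simp_all add: qmult_def quat_eq_iff)

definition hopf :: "quat \<Rightarrow> quat"
  where "hopf z = qcnj z \<odot> qi \<odot> z"

lemma qRe_hopf: "qRe (hopf z) = 0"
  by (simp add: qRe_def hopf_def qmult_def qcnj_def)

lemma R3_of_quat_of_R3 [simp]: "R3_of_quat (quat_of_R3 u) = u"
  by (simp add: R3_of_quat_def quat_of_R3_def vec_eq_iff forall_3)

lemma quat_of_R3_of_hopf: "quat_of_R3 (R3_of_quat (hopf z)) = hopf z"
  using qRe_hopf[of z] by (simp add: R3_of_quat_def quat_of_R3_def quat_eq_iff qRe_def)


section \<open>The regularized Hamiltonian system\<close>

text \<open>Points of the circle \<open>\<real>/T\<int>\<close> are the classes \<open>t + T\<int>\<close>, as sets of reals.\<close>

definition circle_class :: "real \<Rightarrow> real \<Rightarrow> real set"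
  where "circle_class T t = {t + of_int k * T | k. True}"

definition circle :: "real \<Rightarrow> real set set"
  where "circle T = range (circle_class T)"

definition rep :: "real set \<Rightarrow> real"
  where "rep c = (SOME t. t \<in> c)"

lemma circle_class_eq_iff: "circle_class T a = circle_class T b \<longleftrightarrow> (\<exists>k. a = b + of_int k * T)"
proof
  have "a \<in> circle_class T a"
    unfolding circle_class_def by (auto intro!: exI[of _ "0::int"])
  moreover assume "circle_class T a = circle_class T b"
  ultimately show "\<exists>k. a = b + of_int k * T"
    by (auto simp: circle_class_def)
next
  assume "\<exists>k. a = b + of_int k * T"
  then obtain k where a: "a = b + of_int k * T" by blast
  have "x \<in> circle_class T a \<longleftrightarrow> x \<in> circle_class T b" for x
  proof
    assume "x \<in> circle_class T a"
    then obtain m where "x = a + of_int m * T" by (auto simp: circle_class_def)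
    then have "x = b + of_int (k + m) * T" by (simp add: a algebra_simps)
    then show "x \<in> circle_class T b" unfolding circle_class_def by blast
  next
    assume "x \<in> circle_class T b"
    then obtain m where "x = b + of_int m * T" by (auto simp: circle_class_def)
    then have "x = a + of_int (m - k) * T" by (simp add: a algebra_simps)
    then show "x \<in> circle_class T a" unfolding circle_class_def by blast
  qed
  then show "circle_class T a = circle_class T b" by blast
qed

type_synonym phase = "quat \<times> quat \<times> real set \<times> real"

text \<open>The open subset of \<open>\<M>\<close> on which the Hamiltonian is defined.\<close>

definition regularized_domain :: "real \<Rightarrow> (real^3) set \<Rightarrow> phase set" where
  "regularized_domain T \<U> = {(z, w, c, \<tau>). hopf z \<in> quat_of_R3 ` \<U> \<and> c \<in> circle T}"

text \<open>
  The choice of the representative \<open>rep c\<close> is immaterial on \<open>regularized_domain T \<U>\<close> when \<open>U\<close> is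
  \<open>T\<close>-periodic in time.
\<close>

definition K_reg :: "(real \<Rightarrow> real^3 \<Rightarrow> real \<Rightarrow> real) \<Rightarrow> real \<Rightarrow> phase \<Rightarrow> real" where
  "K_reg U \<epsilon> = (\<lambda>(z, w, c, \<tau>).
     (norm w)\<^sup>2 / 8 + \<tau> * (norm z)\<^sup>2 - 1
       - \<epsilon> * (norm z)\<^sup>2 * U (rep c) (R3_of_quat (hopf z)) \<epsilon>)"

lemma K_reg_circle_class:
  assumes per: "\<And>t x e. x \<in> \<U> \<Longrightarrow> e \<in> {0..\<epsilon>\<^sub>0} \<Longrightarrow> U (t + T) x e = U t x e"
    and \<epsilon>: "\<epsilon> \<in> {0..\<epsilon>\<^sub>0}" and z: "hopf z \<in> quat_of_R3 ` \<U>"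
  shows "K_reg U \<epsilon> (z, w, circle_class T t, \<tau>) =
    (norm w)\<^sup>2 / 8 + \<tau> * (norm z)\<^sup>2 - 1 - \<epsilon> * (norm z)\<^sup>2 * U t (R3_of_quat (hopf z)) \<epsilon>"
proof -
  let ?x = "R3_of_quat (hopf z)"
  have x: "?x \<in> \<U>" using z by auto
  have nat: "U (r + of_nat n * T) ?x \<epsilon> = U r ?x \<epsilon>" for r n
  proof (induction n)
    case (Suc n)
    have "U (r + of_nat n * T + T) ?x \<epsilon> = U (r + of_nat n * T) ?x \<epsilon>"
      using per x \<epsilon> by blast
    with Suc show ?case by (simp add: algebra_simps)
  qed simp
  have int: "U (r + of_int k * T) ?x \<epsilon> = U r ?x \<epsilon>" for r k
  proof (cases "k \<ge> 0")
    case True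
    then show ?thesis using nat[of r "nat k"] by simp
  next
    case False
    then show ?thesis using nat[of "r + of_int k * T" "nat (- k)"] by (simp add: algebra_simps)
  qed
  have "t \<in> circle_class T t"
    unfolding circle_class_def by (auto intro!: exI[of _ "0::int"])
  then have "rep (circle_class T t) \<in> circle_class T t"
    unfolding rep_def by (rule someI)
  then obtain k where "rep (circle_class T t) = t + of_int k * T"
    by (auto simp: circle_class_def)
  then show ?thesis using int by (simp add: K_reg_def)
qed

definition BL :: "phase \<Rightarrow> real" where
  "BL = (\<lambda>(z, w, c, \<tau>). qRe (qcnj z \<odot> qi \<odot> w))"

definition S1_act :: "complex \<Rightarrow> phase \<Rightarrow> phase" where
  "S1_act g = (\<lambda>(z, w, c, \<tau>). (quat_of_complex g \<odot> z, quat_of_complex g \<odot> w, c, \<tau>))"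

definition partial_z :: "(phase \<Rightarrow> real) \<Rightarrow> 4 \<Rightarrow> phase \<Rightarrow> real" where
  "partial_z H l = (\<lambda>(z, w, c, \<tau>). deriv (\<lambda>h. H (z + h *\<^sub>R axis l 1, w, c, \<tau>)) 0)"

definition partial_w :: "(phase \<Rightarrow> real) \<Rightarrow> 4 \<Rightarrow> phase \<Rightarrow> real" where
  "partial_w H l = (\<lambda>(z, w, c, \<tau>). deriv (\<lambda>h. H (z, w + h *\<^sub>R axis l 1, c, \<tau>)) 0)"

definition partial_t :: "real \<Rightarrow> (phase \<Rightarrow> real) \<Rightarrow> phase \<Rightarrow> real" where
  "partial_t T H = (\<lambda>(z, w, c, \<tau>). deriv (\<lambda>r. H (z, w, circle_class T r, \<tau>)) (rep c))"

definition partial_\<tau> :: "(phase \<Rightarrow> real) \<Rightarrow> phase \<Rightarrow> real" where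
  "partial_\<tau> H = (\<lambda>(z, w, c, \<tau>). deriv (\<lambda>r. H (z, w, c, r)) \<tau>)"

text \<open>Derivative of a curve in \<open>\<real>/T\<int>\<close>, computed through a local lift \<open>\<theta>\<close>.\<close>

definition has_circle_derivative :: "real \<Rightarrow> (real \<Rightarrow> real set) \<Rightarrow> real \<Rightarrow> real \<Rightarrow> bool" where
  "has_circle_derivative T c d s \<longleftrightarrow>
     (\<exists>\<theta>. (\<forall>\<^sub>F r in nhds s. c r = circle_class T (\<theta> r)) \<and> (\<theta> has_real_derivative d) (at s))"

text \<open>Hamilton's equations on \<open>D\<close> for the form \<open>\<Sum>l. dz\<^sub>l \<and> dw\<^sub>l + dt \<and> d\<tau>\<close>.\<close>

definition hamiltonian_solution ::
  "real \<Rightarrow> phase set \<Rightarrow> (phase \<Rightarrow> real) \<Rightarrow> (real \<Rightarrow> phase) \<Rightarrow> bool"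
where
  "hamiltonian_solution T D H X \<longleftrightarrow>
     (\<forall>s. X s \<in> D) \<and>
     (\<exists>z w c \<tau>. X = (\<lambda>s. (z s, w s, c s, \<tau> s)) \<and>
        (\<forall>s. (\<forall>l. ((\<lambda>r. z r $ l) has_real_derivative partial_w H l (X s)) (at s)) \<and>
             (\<forall>l. ((\<lambda>r. w r $ l) has_real_derivative - partial_z H l (X s)) (at s)) \<and>
             has_circle_derivative T c (partial_\<tau> H (X s)) s \<and>
             (\<tau> has_real_derivative - partial_t T H (X s)) (at s)))"

end

(*
  The time integral of 1/|u| converges through a collision without any asymptotic expansion: with
  B = u . u' one has B' = 1/|u| + (a function that is continuous across collisions), and B tends to 0
  at a collision because the energy stays bounded.  So the fictitious time s with ds/dt = 1/|u| is B
  minus an ordinary integral.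

  In the time s the direction n = u/|u| extends to a C^1 curve on the sphere, with n' = q x n and
  q = (u x u')/|u|, since the angular momentum vanishes at a collision faster than |u|.  Its
  horizontal lift zeta to the unit quaternions solves the linear equation zeta' = - zeta q / 2.
  The regularized solution is z = rho zeta, where rho^2 = |u| and rho changes sign at every
  collision.  Hamilton's equations hold off the collisions by direct computation, and both sides
  are continuous, so they hold across collisions as well.  Over one period zeta is multiplied from
  the left by a constant that commutes with i, and rho by a sign.
*)

theory Submission
  imports Defs
begin

text \<open>At a collision the velocity is unbounded, so only combinations that keep a limit can be
  carried across. With \<open>c = u x u'\<close>, Lagrange's identity and the energy give
  \<open>B^2 + |c|^2 = 2 r + 2 h r^2\<close>, where \<open>r = |u|\<close>; hence \<open>B\<close>
  and \<open>c\<close> tend to 0. Since \<open>r B'\<close> tends to 1, \<open>B\<close> passes from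
  negative to positive, so \<open>r\<close> is monotone on each side of \<open>t0\<close>; with
  \<open>|c'| \<le> M r\<close> this yields \<open>|c| \<le> M r |t - t0|\<close>, and
  \<open>q\<close> tends to 0. The sign change of \<rho> is forced: its derivative in the time s is
  \<open>B / (2 \<rho>)\<close>, whose square tends to 1/2; as \<open>B\<close> changes sign,
  continuity requires that \<rho> does too. The factor -1/2 in the equation of \<zeta> reflects that
  conjugation by unit quaternions doubles angles. As \<open>q\<close> is orthogonal to
  \<open>n\<close>, the lift is horizontal, which is \<open>BL = 0\<close>. In \<open>z''\<close>
  the terms with \<open>B / r\<close> and \<open>|q|^2\<close> cancel and
  \<open>z (h - u f) / 2\<close> remains, which is continuous. The energy has derivative
  \<open>f \<bullet> v\<close> with \<open>v\<close> unbounded, but in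
  \<open>\<tau> = \<epsilon> U - h\<close> this work term drops out.\<close>

section \<open>Calculus on the line\<close>

text \<open>On \<open>[x - 1, x + 1]\<close> the set \<open>Z\<close> is finite, and the fundamental
  theorem of calculus tolerates a finite exceptional set. So \<open>f\<close> is there an integral
  of the continuous \<open>g\<close> and is differentiable at the points of \<open>Z\<close> too.
  This carries differential equations across collisions.\<close>

lemma has_vector_derivative_across_discrete:
  fixes f :: "real \<Rightarrow> 'a::banach"
  assumes "continuous_on UNIV f" "continuous_on UNIV g"
    and Z: "\<And>x. \<not> x islimpt Z"
    and der: "\<And>x. x \<notin> Z \<Longrightarrow> (f has_vector_derivative g x) (at x)"
  shows "(f has_vector_derivative g x) (at x)"
proof -
  let ?a = "x - 1" and ?b = "x + 1"
  have "finite ({?a..?b} \<inter> Z)"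
    using finite_not_islimpt_in_compact[of "{?a..?b}" Z] Z by simp
  then have int: "(g has_integral f y - f ?a) {?a..y}" if "y \<in> {?a..?b}" for y
    using that by (intro fundamental_theorem_of_calculus_strong[of "{?a..?b} \<inter> Z"])
      (auto intro: der continuous_on_subset[OF assms(1)])
  have "((\<lambda>y. integral {?a..y} g + f ?a) has_vector_derivative g x) (at x within {?a..?b})"
    by (auto intro!: derivative_eq_intros integral_has_vector_derivative
        continuous_on_subset[OF assms(2)])
  then have "(f has_vector_derivative g x) (at x within {?a..?b})"
    by (rule has_vector_derivative_transform[rotated 2]) (use int[THEN integral_unique] in auto)
  then show ?thesis
    using at_within_Icc_at[of ?a x ?b] by simp
qed

text \<open>An injective continuous map sends punctured neighbourhoods into punctured
  neighbourhoods. Applied to the time change, it keeps collisions isolated in the fictitious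
  time.\<close>

lemma not_islimpt_vimage_inj:
  fixes \<theta> :: "'a::t2_space \<Rightarrow> 'b::t2_space"
  assumes cont: "continuous_on UNIV \<theta>" and inj: "inj \<theta>" and Z: "\<not> \<theta> x islimpt Z"
  shows "\<not> x islimpt {x. \<theta> x \<in> Z}"
proof -
  have "\<theta> \<midarrow>x\<rightarrow> \<theta> x" using cont by (simp add: continuous_on_def)
  moreover have "\<forall>\<^sub>F y in at x. \<theta> y \<noteq> \<theta> x"
    unfolding eventually_at_filter using inj by (simp add: inj_eq)
  ultimately have "filterlim \<theta> (at (\<theta> x)) (at x)"
    by (simp add: filterlim_at)
  moreover have "\<forall>\<^sub>F y in at (\<theta> x). y \<notin> Z" using Z by (simp add: islimpt_iff_eventually)
  ultimately have "\<forall>\<^sub>F y in at x. \<theta> y \<notin> Z" by (rule eventually_compose_filterlim[rotated])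
  then show ?thesis by (simp add: islimpt_iff_eventually)
qed

lemma constant_if_zero_derivative_off_discrete:
  fixes f :: "real \<Rightarrow> 'a::banach"
  assumes "continuous_on UNIV f" "\<And>x. \<not> x islimpt Z"
    and "\<And>x. x \<notin> Z \<Longrightarrow> (f has_vector_derivative 0) (at x)"
  shows "f x = f y"
proof -
  have "(f has_vector_derivative 0) (at x)" for x
    using has_vector_derivative_across_discrete[of f "\<lambda>_. 0" Z] assms by simp
  then show ?thesis
    using has_vector_derivative_zero_constant[of UNIV f] by (metis UNIV_I convex_UNIV)
qed

text \<open>Extends periodicity and unit length to the collisions, where direction and energy are
  known only as limits.\<close>

lemma eq_if_eq_off_discrete:
  fixes f g :: "real \<Rightarrow> 'a::t2_space"
  assumes "continuous_on UNIV f" "continuous_on UNIV g" "\<And>x. \<not> x islimpt Z"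
    and "\<And>x. x \<notin> Z \<Longrightarrow> f x = g x"
  shows "f x = g x"
proof -
  have "f \<midarrow>x\<rightarrow> f x" "g \<midarrow>x\<rightarrow> g x"
    using assms by (auto simp: continuous_on_def)
  moreover have "\<forall>\<^sub>F y in at x. f y = g y"
    using assms(3)[of x] assms(4) eventually_mono[of "\<lambda>y. y \<notin> Z" "at x" "\<lambda>y. f y = g y"]
    unfolding islimpt_iff_eventually by blast
  ultimately have "f \<midarrow>x\<rightarrow> g x"
    using filterlim_cong by (metis (mono_tags, lifting))
  with \<open>f \<midarrow>x\<rightarrow> f x\<close> show ?thesis
    using tendsto_unique trivial_limit_at by blast
qed

lemma antiderivative_on_line:
  fixes f :: "real \<Rightarrow> 'a::banach"
  assumes "continuous_on UNIV f"
  obtains F where "F 0 = 0" "\<And>x. (F has_vector_derivative f x) (at x)"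
proof -
  \<comment> \<open>One of the two intervals is empty or a single point, so this is the oriented
    integral from 0 to \<open>x\<close>.\<close>
  define F where "F = (\<lambda>x. integral {0..x} f - integral {x..0} f)"
  have F0: "F 0 = 0" by (simp add: F_def)
  have "(F has_vector_derivative f x) (at x)" for x :: real
  proof -
    let ?a = "- \<bar>x\<bar> - 1" and ?b = "\<bar>x\<bar> + 1"
    have int: "f integrable_on {c..d}" for c d
      using assms continuous_on_subset integrable_continuous_real by blast
    have F: "F y = integral {?a..y} f - integral {?a..0} f" if "y \<in> {?a..?b}" for y
    proof (cases "0 \<le> y")
      case True
      then show ?thesis
        using Henstock_Kurzweil_Integration.integral_combine[of ?a 0 y f, OF _ True int] abs_ge_zero[of x]
        by (cases "y = 0") (simp_all add: F_def eq_diff_eq add.commute)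
    next
      case False
      then show ?thesis
        using Henstock_Kurzweil_Integration.integral_combine[of ?a y 0 f, OF _ _ int] that
        by (simp add: F_def eq_diff_eq add.commute diff_eq_eq)
    qed
    have "((\<lambda>y. integral {?a..y} f - integral {?a..0} f) has_vector_derivative f x) (at x within {?a..?b})"
      by (auto intro!: derivative_eq_intros integral_has_vector_derivative
          continuous_on_subset[OF assms])
    then have "(F has_vector_derivative f x) (at x within {?a..?b})"
      by (rule has_vector_derivative_transform[rotated 2]) (use F in auto)
    moreover have "?a < x" "x < ?b" by linarith+
    ultimately show ?thesis
      using at_within_Icc_at[of ?a x ?b] by simp
  qed
  with F0 that show ?thesis by blast
qed

section \<open>Global solutions of linear differential equations\<close>

lemma norm_le_if_derivative_le_power:
  fixes f :: "real \<Rightarrow> 'a::real_normed_vector"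
  assumes "f 0 = 0" "\<And>x. (f has_vector_derivative f' x) (at x)"
    and "\<And>x. \<bar>x\<bar> \<le> R \<Longrightarrow> norm (f' x) \<le> C * \<bar>x\<bar> ^ n" and "\<bar>x\<bar> \<le> R"
  shows "norm (f x) \<le> C * \<bar>x\<bar> ^ Suc n / Suc n"
proof -
  have pos: "norm (f x) \<le> C * x ^ Suc n / Suc n"
    if "f 0 = 0" "\<And>x. (f has_vector_derivative f' x) (at x)"
      "\<And>x. 0 \<le> x \<Longrightarrow> x \<le> R \<Longrightarrow> norm (f' x) \<le> C * x ^ n" "0 < x" "x \<le> R"
    for f :: "real \<Rightarrow> 'a" and f' x
  proof -
    have "norm (f x - f 0) \<le> C * x ^ Suc n / Suc n - C * 0 ^ Suc n / Suc n"
    proof (rule differentiable_bound_general[of 0 x f "\<lambda>x. C * x ^ Suc n / Suc n" f' "\<lambda>x. C * x ^ n"])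
      show "continuous_on {0..x} f"
        using that(2) by (meson continuous_at_imp_continuous_on has_vector_derivative_continuous)
      fix y
      have "((\<lambda>x. C * x ^ Suc n / Suc n) has_real_derivative C * y ^ n) (at y)"
        by (auto intro!: derivative_eq_intros simp del: power_Suc)
      then show "((\<lambda>x. C * x ^ Suc n / Suc n) has_vector_derivative C * y ^ n) (at y)"
        by (simp only: has_real_derivative_iff_has_vector_derivative)
    qed (use that in \<open>auto intro!: continuous_intros\<close>)
    then show ?thesis using that by simp
  qed
  consider "x = 0" | "x > 0" | "x < 0" by linarith
  then show ?thesis
  proof cases
    case 2
    have "norm (f x) \<le> C * x ^ Suc n / Suc n"
      proof (rule pos[OF assms(1,2)])
      fix y assume "0 \<le> y" "y \<le> R"
      then show "norm (f' y) \<le> C * y ^ n" using assms(3)[of y] by simp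
    qed (use assms(4) 2 in auto)
    then show ?thesis using 2 by simp
  next
    case 3
    have "((\<lambda>x. f (- x)) has_vector_derivative - f' (- x)) (at x)" for x
    proof -
      have "((\<lambda>x::real. - x) has_vector_derivative - 1) (at x)"
        by (auto intro!: derivative_eq_intros)
      from vector_diff_chain_at[OF this assms(2)] show ?thesis by (simp add: o_def)
    qed
    moreover have "norm (- f' (- y)) \<le> C * y ^ n" if "0 \<le> y" "y \<le> R" for y
      using assms(3)[of "- y"] that by simp
    ultimately have "norm (f (- (- x))) \<le> C * (- x) ^ Suc n / Suc n"
      by (intro pos[of "\<lambda>x. f (- x)"]) (use assms 3 in auto)
    then show ?thesis using 3 by simp
  qed (use assms in auto)
qed

text \<open>Picard series: \<open>y\<close> is the sum of the \<open>Y n\<close>, where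
  \<open>Y (Suc n)\<close> is the antiderivative of \<open>A Y n\<close> vanishing at 0. Each
  integration contributes one factor \<open>|x| / (n + 1)\<close>, so
  \<open>|Y n| \<le> |y0| (K |x|)^n / n!\<close> on every bounded interval, and the series converges
  on the whole line.\<close>

lemma linear_ode_solution:
  fixes A :: "real \<Rightarrow> ('a::banach \<Rightarrow>\<^sub>L 'a)"
  assumes A: "continuous_on UNIV A"
  obtains y where "y 0 = y0" "\<And>x. (y has_vector_derivative blinfun_apply (A x) (y x)) (at x)"
proof -
  \<comment> \<open>\<open>prim f\<close> is meaningful only for continuous \<open>f\<close>; a
    total operator is used because the recursion for \<open>Y\<close> is written down before its
    terms are known to be continuous.\<close>
  define prim where "prim = (\<lambda>f::real \<Rightarrow> 'a. SOME F. F 0 = 0 \<and> (\<forall>x. (F has_vector_derivative f x) (at x)))"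
  have prim: "prim f 0 = 0" "(prim f has_vector_derivative f x) (at x)"
    if "continuous_on UNIV f" for f x
  proof -
    have "\<exists>F. F 0 = 0 \<and> (\<forall>x. (F has_vector_derivative f x) (at x))"
      using antiderivative_on_line[OF that] by metis
    from someI_ex[OF this] show "prim f 0 = 0" "(prim f has_vector_derivative f x) (at x)"
      by (auto simp: prim_def)
  qed
  define Y where "Y = rec_nat (\<lambda>_. y0) (\<lambda>_ f. prim (\<lambda>x. blinfun_apply (A x) (f x)))"
  have Y0: "Y 0 = (\<lambda>_. y0)" and YS: "Y (Suc n) = prim (\<lambda>x. blinfun_apply (A x) (Y n x))" for n
    by (simp_all add: Y_def)
  have contY: "continuous_on UNIV (Y n)" for n
  proof (induction n)
    case (Suc n)
    have "continuous_on UNIV (\<lambda>x. blinfun_apply (A x) (Y n x))"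
      using A Suc by (intro continuous_intros)
    from prim(2)[OF this] show ?case
      unfolding YS by (meson continuous_at_imp_continuous_on has_vector_derivative_continuous)
  qed (simp add: Y0)
  have contAY: "continuous_on UNIV (\<lambda>x. blinfun_apply (A x) (Y n x))" for n
    using A contY by (intro continuous_intros)
  define Y' where "Y' = rec_nat (\<lambda>_. 0) (\<lambda>n _ x. blinfun_apply (A x) (Y n x))"
  have Y'0: "Y' 0 = (\<lambda>_. 0)" and Y'S: "Y' (Suc n) = (\<lambda>x. blinfun_apply (A x) (Y n x))" for n
    by (simp_all add: Y'_def)
  have derY: "(Y n has_vector_derivative Y' n x) (at x)" for n x
    using prim(2)[OF contAY] by (cases n) (auto simp: Y0 YS Y'0 Y'S)
  have YSz: "Y (Suc n) 0 = 0" for n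
    using prim(1)[OF contAY] by (simp add: YS)
  define y where "y = (\<lambda>x. \<Sum>n. Y n x)"
  have main: "(\<forall>x\<in>{-R..R}. summable (\<lambda>n. Y n x)) \<and>
     (\<forall>x\<in>{-R<..<R}. (y has_vector_derivative blinfun_apply (A x) (y x)) (at x))" if "R > 0" for R
  proof -
    have "bounded (A ` {-R..R})"
      using A by (intro compact_imp_bounded compact_continuous_image) (auto intro: continuous_on_subset)
    then obtain K where K: "K > 0" "\<And>x. \<bar>x\<bar> \<le> R \<Longrightarrow> norm (A x) \<le> K"
      unfolding bounded_pos by (metis abs_le_iff atLeastAtMost_iff imageI minus_le_iff)
    have AK: "norm (blinfun_apply (A x) v) \<le> K * norm v" if "\<bar>x\<bar> \<le> R" for x v
      using norm_blinfun[of "A x" v] K(2)[OF that] by (meson mult_right_mono norm_ge_zero order_trans)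
    have bnd: "norm (Y n x) \<le> (norm y0 * K ^ n / fact n) * \<bar>x\<bar> ^ n" if "\<bar>x\<bar> \<le> R" for n x
      using that
    proof (induction n arbitrary: x)
      case (Suc n)
      have "norm (Y (Suc n) x) \<le> (K * (norm y0 * K ^ n / fact n)) * \<bar>x\<bar> ^ Suc n / Suc n"
      proof (rule norm_le_if_derivative_le_power[OF YSz derY _ Suc.prems])
        fix x :: real assume "\<bar>x\<bar> \<le> R"
        then show "norm (Y' (Suc n) x) \<le> (K * (norm y0 * K ^ n / fact n)) * \<bar>x\<bar> ^ n"
          using AK[of x "Y n x"] mult_left_mono[OF Suc.IH[of x], of K] K(1)
          unfolding Y'S by (simp add: mult.assoc)
      qed
      then show ?case by (simp add: field_simps)
    qed (simp add: Y0)
    define M where "M n = norm y0 * ((K * R) ^ n / fact n)" for n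
    have bndM: "norm (Y n x) \<le> M n" if "x \<in> {-R..R}" for n x
    proof -
      have "norm (Y n x) \<le> (norm y0 * K ^ n / fact n) * \<bar>x\<bar> ^ n"
        using bnd that by auto
      also have "\<dots> \<le> (norm y0 * K ^ n / fact n) * R ^ n"
        using that K(1) by (intro mult_left_mono power_mono) auto
      finally show ?thesis by (simp add: M_def power_mult_distrib)
    qed
    have "summable M"
      unfolding M_def using summable_exp_generic[of "K * R"] by (intro summable_mult) (simp add: divide_inverse mult.commute)
    have unif: "uniform_limit {-R..R} (\<lambda>n x. \<Sum>i<n. Y i x) y sequentially"
      unfolding y_def by (rule Weierstrass_m_test[OF bndM \<open>summable M\<close>])
    have summ: "summable (\<lambda>n. Y n x)" if "x \<in> {-R..R}" for x
      by (rule summable_comparison_test'[OF \<open>summable M\<close>, of 0]) (rule bndM[OF that])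
    \<comment> \<open>Index shift: as \<open>Y' 0 = 0\<close>, differentiating \<open>n + 1\<close>
      terms of the series gives \<open>A x\<close> applied to the first \<open>n\<close>
      terms.\<close>
    have sumY': "(\<Sum>i<Suc n. Y' i x) = blinfun_apply (A x) (\<Sum>i<n. Y i x)" for n x
      by (simp add: sum.lessThan_Suc_shift Y'0 Y'S blinfun.sum_right del: sum.lessThan_Suc)
    have "\<exists>g. \<forall>x\<in>{-R..R}. (\<lambda>n. Y n x) sums g x \<and>
        (g has_derivative (\<lambda>h. h *\<^sub>R blinfun_apply (A x) (y x))) (at x within {-R..R})"
    proof (rule has_derivative_series[where f' = "\<lambda>n x h. h *\<^sub>R Y' n x" and x = 0])
      show "(Y n has_derivative (\<lambda>h. h *\<^sub>R Y' n x)) (at x within {-R..R})" for n x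
        using derY has_vector_derivative_def has_vector_derivative_at_within by blast
      show "(\<lambda>n. Y n 0) sums (\<Sum>n. Y n 0)"
        using summ[of 0] \<open>R > 0\<close> by (simp add: summable_sums)
      fix e :: real assume "e > 0"
      \<comment> \<open>\<open>A x\<close> magnifies the error of a partial sum by at most
        \<open>K\<close>.\<close>
      then have "e / K > 0" using K by simp
      with unif have "\<forall>\<^sub>F n in sequentially. \<forall>x\<in>{-R..R}. dist (\<Sum>i<n. Y i x) (y x) < e / K"
        unfolding uniform_limit_iff by blast
      then have "\<forall>\<^sub>F n in sequentially. \<forall>x\<in>{-R..R}. \<forall>h.
         norm ((\<Sum>i<Suc n. h *\<^sub>R Y' i x) - h *\<^sub>R blinfun_apply (A x) (y x)) \<le> e * norm h"
      proof (eventually_elim, intro ballI allI)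
        fix n x and h :: real
        assume n: "\<forall>x\<in>{-R..R}. dist (\<Sum>i<n. Y i x) (y x) < e / K" and x: "x \<in> {-R..R}"
        have "norm (blinfun_apply (A x) ((\<Sum>i<n. Y i x) - y x)) \<le> K * (e / K)"
        proof -
          have "norm ((\<Sum>i<n. Y i x) - y x) \<le> e / K"
            using n x by (auto simp: dist_norm less_imp_le)
          then show ?thesis
            using AK[of x "(\<Sum>i<n. Y i x) - y x"] x K(1) mult_left_mono[of _ "e / K" K]
            by (fastforce simp: abs_le_iff intro: order_trans)
        qed
        then have *: "norm (blinfun_apply (A x) ((\<Sum>i<n. Y i x) - y x)) \<le> e"
          using K by simp
        have "(\<Sum>i<Suc n. h *\<^sub>R Y' i x) - h *\<^sub>R blinfun_apply (A x) (y x) =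
            h *\<^sub>R blinfun_apply (A x) ((\<Sum>i<n. Y i x) - y x)"
          by (simp only: scaleR_sum_right[symmetric] sumY' blinfun.diff_right scaleR_diff_right)
        then show "norm ((\<Sum>i<Suc n. h *\<^sub>R Y' i x) - h *\<^sub>R blinfun_apply (A x) (y x)) \<le> e * norm h"
          using mult_right_mono[OF *, of "\<bar>h\<bar>"] by (simp only: norm_scaleR real_norm_def mult.commute abs_ge_zero simp_thms)
      qed
      then show "\<forall>\<^sub>F n in sequentially. \<forall>x\<in>{-R..R}. \<forall>h.
         norm ((\<Sum>i<n. h *\<^sub>R Y' i x) - h *\<^sub>R blinfun_apply (A x) (y x)) \<le> e * norm h"
        by (rule eventually_sequentially_Suc[THEN iffD1])
    qed (use \<open>R > 0\<close> in auto)
    then obtain g where g: "\<And>x. x \<in> {-R..R} \<Longrightarrow> (\<lambda>n. Y n x) sums g x"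
      "\<And>x. x \<in> {-R..R} \<Longrightarrow> (g has_vector_derivative blinfun_apply (A x) (y x)) (at x within {-R..R})"
      unfolding has_vector_derivative_def by blast
    have "(y has_vector_derivative blinfun_apply (A x) (y x)) (at x)" if x: "x \<in> {-R<..<R}" for x
    proof -
      have "(y has_vector_derivative blinfun_apply (A x) (y x)) (at x within {-R..R})"
        by (rule has_vector_derivative_transform[OF _ _ g(2)]) 
          (use x g(1) in \<open>auto simp: y_def sums_iff\<close>)
      then show ?thesis using x at_within_Icc_at[of "-R" x R] by simp
    qed
    with summ show ?thesis by blast
  qed
  show ?thesis
  proof
    have "Y n 0 = 0" if "n \<notin> {0}" for n
      using that YSz by (cases n) auto
    then have "(\<lambda>n. Y n 0) sums (\<Sum>n\<in>{0}. Y n 0)"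
      by (intro sums_finite) auto
    then show "y 0 = y0" by (simp add: y_def Y0 sums_iff)
    show "(y has_vector_derivative blinfun_apply (A x) (y x)) (at x)" for x
    proof -
      have "x \<in> {- (\<bar>x\<bar> + 1)<..<\<bar>x\<bar> + 1}" unfolding greaterThanLessThan_iff by linarith
      moreover have "\<bar>x\<bar> + 1 > 0" by linarith
      ultimately show ?thesis using main by blast
    qed
  qed
qed

section \<open>Quaternions and the Hopf map\<close>

lemma sum_quat_index: "(\<Sum>l\<in>UNIV. f (l::4)) = f 0 + f 1 + f 2 + (f 3 :: 'a::ab_group_add)"
proof -
  have "(4::4) = 0" by simp
  then have "f 4 = f 0" by (rule arg_cong)
  then show ?thesis by (simp add: sum_4 add.commute add.left_commute)
qed

lemma inner_quat: "(p::quat) \<bullet> q = p$0 * q$0 + p$1 * q$1 + p$2 * q$2 + p$3 * q$3"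
  by (simp add: inner_vec_def sum_quat_index)

lemma norm_quat_sq: "(norm (p::quat))\<^sup>2 = (p$0)\<^sup>2 + (p$1)\<^sup>2 + (p$2)\<^sup>2 + (p$3)\<^sup>2"
  unfolding power2_norm_eq_inner inner_quat by (simp add: power2_eq_square)

lemma norm_R3_sq: "(norm (x::real^3))\<^sup>2 = (x$1)\<^sup>2 + (x$2)\<^sup>2 + (x$3)\<^sup>2"
  unfolding power2_norm_eq_inner inner_vec_def sum_3 by (simp add: power2_eq_square)

lemma qmult_nth [simp]:
  "(p \<odot> q) $ 0 = p $ 0 * q $ 0 - p $ 1 * q $ 1 - p $ 2 * q $ 2 - p $ 3 * q $ 3"
  "(p \<odot> q) $ 1 = p $ 0 * q $ 1 + p $ 1 * q $ 0 + p $ 2 * q $ 3 - p $ 3 * q $ 2"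
  "(p \<odot> q) $ 2 = p $ 0 * q $ 2 - p $ 1 * q $ 3 + p $ 2 * q $ 0 + p $ 3 * q $ 1"
  "(p \<odot> q) $ 3 = p $ 0 * q $ 3 + p $ 1 * q $ 2 - p $ 2 * q $ 1 + p $ 3 * q $ 0"
  by (simp_all add: qmult_def)

lemma qcnj_nth [simp]:
  "qcnj p $ 0 = p $ 0" "qcnj p $ 1 = - p $ 1" "qcnj p $ 2 = - p $ 2" "qcnj p $ 3 = - p $ 3"
  by (simp_all add: qcnj_def)

lemma quat_of_R3_nth [simp]:
  "quat_of_R3 x $ 0 = 0" "quat_of_R3 x $ 1 = x $ 1" "quat_of_R3 x $ 2 = x $ 2" "quat_of_R3 x $ 3 = x $ 3"
  by (simp_all add: quat_of_R3_def)

lemma quat_of_complex_nth [simp]: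
  "quat_of_complex g $ 0 = Re g" "quat_of_complex g $ 1 = Im g" "quat_of_complex g $ 2 = 0"
  "quat_of_complex g $ 3 = 0"
  by (simp_all add: quat_of_complex_def)

lemma R3_of_quat_nth [simp]:
  "R3_of_quat p $ 1 = p $ 1" "R3_of_quat p $ 2 = p $ 2" "R3_of_quat p $ 3 = p $ 3"
  by (simp_all add: R3_of_quat_def)

abbreviation qone :: quat where "qone \<equiv> quat 1 0 0 0"

lemma qmult_assoc: "(p \<odot> q) \<odot> r = p \<odot> (q \<odot> r)"
  by (simp add: quat_eq_iff algebra_simps)

lemma qone_mult [simp]: "qone \<odot> p = p" "p \<odot> qone = p"
  by (simp_all add: quat_eq_iff)

lemma qcnj_mult: "qcnj (p \<odot> q) = qcnj q \<odot> qcnj p"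
  by (simp add: quat_eq_iff algebra_simps)

lemma qmult_qcnj: "p \<odot> qcnj p = (norm p)\<^sup>2 *\<^sub>R qone" "qcnj p \<odot> p = (norm p)\<^sup>2 *\<^sub>R qone"
  unfolding norm_quat_sq by (simp_all add: quat_eq_iff power2_eq_square algebra_simps)

lemma norm_qcnj [simp]: "norm (qcnj p) = norm p"
  by (rule power2_eq_imp_eq) (simp_all add: norm_quat_sq)

lemma norm_qmult: "norm (p \<odot> q) = norm p * norm q"
proof (rule power2_eq_imp_eq)
  show "(norm (p \<odot> q))\<^sup>2 = (norm p * norm q)\<^sup>2"
    unfolding power_mult_distrib norm_quat_sq qmult_nth by algebra
qed auto

lemma norm_quat_of_R3 [simp]: "norm (quat_of_R3 x) = norm x"
  by (rule power2_eq_imp_eq) (simp_all add: norm_quat_sq norm_R3_sq)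

lemma qcnj_quat_of_R3 [simp]: "qcnj (quat_of_R3 x) = - quat_of_R3 x"
  by (simp add: quat_eq_iff)

lemma bounded_bilinear_qmult: "bounded_bilinear (\<odot>)"
  by (rule bounded_bilinear.intro)
    (auto simp: quat_eq_iff algebra_simps norm_qmult intro!: exI[of _ 1])

lemma bounded_linear_quat_of_R3: "bounded_linear quat_of_R3"
  by (rule bounded_linear_intro[of _ 1]) (auto simp: quat_eq_iff)

lemma bounded_linear_qcnj: "bounded_linear qcnj"
  by (rule bounded_linear_intro[of _ 1]) (auto simp: quat_eq_iff)

lemma bounded_linear_R3_of_quat: "bounded_linear R3_of_quat"
proof (rule bounded_linear_intro[of _ 1])
  fix p
  have "(norm (R3_of_quat p))\<^sup>2 \<le> (norm p)\<^sup>2"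
    unfolding norm_quat_sq norm_R3_sq by simp
  then show "norm (R3_of_quat p) \<le> norm p * 1"
    using power2_le_imp_le[of "norm (R3_of_quat p)" "norm p"] by simp
qed (auto simp: vec_eq_iff forall_3)

lemmas qmult_derivative_intros =
  bounded_bilinear.has_vector_derivative[OF bounded_bilinear_qmult]
  bounded_linear.has_vector_derivative[OF bounded_linear_quat_of_R3]
  bounded_linear.has_vector_derivative[OF bounded_linear_qcnj]

lemmas quat_linear_simps =
  bounded_bilinear.add_left[OF bounded_bilinear_qmult]
  bounded_bilinear.add_right[OF bounded_bilinear_qmult]
  bounded_bilinear.diff_left[OF bounded_bilinear_qmult]
  bounded_bilinear.diff_right[OF bounded_bilinear_qmult]
  bounded_bilinear.scaleR_left[OF bounded_bilinear_qmult]
  bounded_bilinear.scaleR_right[OF bounded_bilinear_qmult]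
  bounded_bilinear.minus_left[OF bounded_bilinear_qmult]
  bounded_bilinear.minus_right[OF bounded_bilinear_qmult]
  bounded_linear.linear[OF bounded_linear_quat_of_R3, THEN linear_add]
  bounded_linear.linear[OF bounded_linear_quat_of_R3, THEN linear_diff]
  bounded_linear.linear[OF bounded_linear_quat_of_R3, THEN linear_neg]
  bounded_linear.linear[OF bounded_linear_quat_of_R3, THEN linear_scale]

lemmas continuous_on_qmult = bounded_bilinear.continuous_on[OF bounded_bilinear_qmult]
lemmas continuous_on_quat_of_R3 = bounded_linear.continuous_on[OF bounded_linear_quat_of_R3]

text \<open>Lets the terms \<open>u \<bullet> f\<close> and \<open>cross3 u f\<close> of the lifted
  equation merge into a single product.\<close>

lemma quat_of_R3_mult:
  "quat_of_R3 x \<odot> quat_of_R3 y = - (x \<bullet> y) *\<^sub>R qone + quat_of_R3 (cross3 x y)"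
  by (simp add: quat_eq_iff inner_vec_def sum_3 cross_components algebra_simps)

lemma hopf_qmult: "hopf (p \<odot> q) = qcnj q \<odot> hopf p \<odot> q"
  by (simp add: hopf_def qcnj_mult qmult_assoc)

lemma hopf_scaleR: "hopf (a *\<^sub>R p) = a\<^sup>2 *\<^sub>R hopf p"
  by (simp add: hopf_def quat_eq_iff power2_eq_square algebra_simps)

text \<open>Left multiplication by the circle moves a point within its Hopf fibre, so a preimage may
  be sought in the form \<open>a + c j + d k\<close>. Then \<open>a^2 - c^2 - d^2\<close>,
  \<open>- 2 a d\<close> and \<open>2 a c\<close> must be the components of \<open>n\<close>, which
  fixes the preimage up to sign unless \<open>a = 0\<close>, that is \<open>n = -i\<close>; there
  \<open>j\<close> serves.\<close>

lemma hopf_onto_sphere: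
  assumes "norm n = 1"
  obtains p where "norm p = 1" "hopf p = quat_of_R3 n"
proof -
  have n: "(n$1)\<^sup>2 + (n$2)\<^sup>2 + (n$3)\<^sup>2 = 1"
    using assms norm_R3_sq[of n] by simp
  show ?thesis
  proof (cases "n$1 = -1")
    case True
    then have "(n$2)\<^sup>2 + (n$3)\<^sup>2 = 0" using n by simp
    then have "n$2 = 0" "n$3 = 0" by (simp_all add: sum_power2_eq_zero_iff)
    with True have "hopf (quat 0 0 1 0) = quat_of_R3 n"
      by (simp add: hopf_def quat_eq_iff)
    moreover have "norm (quat 0 0 1 0) = 1"
      using norm_quat_sq[of "quat 0 0 1 0"] by (simp add: abs_square_eq_1)
    ultimately show ?thesis by (rule that[rotated])
  next
    case False
    have "(n$1)\<^sup>2 \<le> 1" using n by (smt (verit) zero_le_power2)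
    then have "\<bar>n$1\<bar> \<le> 1" by (simp add: abs_square_le_1)
    with False have pos: "1 + n$1 > 0" by simp
    define a where "a = sqrt ((1 + n$1) / 2)"
    have a: "a > 0" "a\<^sup>2 = (1 + n$1) / 2" using pos by (auto simp: a_def)
    let ?c = "n$3 / (2 * a)" and ?d = "- (n$2 / (2 * a))"
    have cd: "?c\<^sup>2 + ?d\<^sup>2 = (1 - n$1) / 2"
    proof -
      have "?c\<^sup>2 + ?d\<^sup>2 = ((n$2)\<^sup>2 + (n$3)\<^sup>2) / (4 * a\<^sup>2)"
        by (simp add: power_divide power_mult_distrib add_divide_distrib)
      also have "(n$2)\<^sup>2 + (n$3)\<^sup>2 = (1 - n$1) * (1 + n$1)"
        using n by (simp add: power2_eq_square algebra_simps)
      finally show ?thesis using pos by (simp add: a(2) divide_simps)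
    qed
    show ?thesis
    proof (rule that[of "quat a 0 ?c ?d"])
      show "norm (quat a 0 ?c ?d) = 1"
      proof (rule power2_eq_imp_eq)
        have "(norm (quat a 0 ?c ?d))\<^sup>2 = a\<^sup>2 + (?c\<^sup>2 + ?d\<^sup>2)"
          unfolding norm_quat_sq quat_nth by simp
        then show "(norm (quat a 0 ?c ?d))\<^sup>2 = 1\<^sup>2"
          unfolding cd a(2) by (simp add: field_simps)
      qed auto
      have "a\<^sup>2 - ?c\<^sup>2 - ?d\<^sup>2 = n $ 1"
        unfolding diff_diff_eq cd a(2) by (simp add: field_simps)
      then show "hopf (quat a 0 ?c ?d) = quat_of_R3 n"
        using a(1) by (simp add: hopf_def quat_eq_iff power2_eq_square)
    qed
  qed
qed

text \<open>For a unit quaternion the hypothesis says that \<open>q\<close> commutes with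
  \<open>i\<close>, and the centralizer of \<open>i\<close> is the complex plane.\<close>

lemma hopf_stabilizer_of_qi:
  assumes "norm q = 1" "hopf q = qi"
  obtains g where "cmod g = 1" "q = quat_of_complex g"
proof
  have "q \<odot> hopf q = qi \<odot> q"
    by (simp add: hopf_def qmult_assoc[symmetric] qmult_qcnj assms(1))
  then have "q \<odot> qi = qi \<odot> q" by (simp add: assms(2))
  then have "q $ 2 = 0" "q $ 3 = 0" by (auto simp: quat_eq_iff)
  then show "q = quat_of_complex (Complex (q $ 0) (q $ 1))"
    by (simp add: quat_eq_iff)
  show "cmod (Complex (q $ 0) (q $ 1)) = 1"
    using norm_quat_sq[of q] assms(1) \<open>q $ 2 = 0\<close> \<open>q $ 3 = 0\<close> by (simp add: cmod_def)
qed

text \<open>The argument on the left is the derivative of \<open>hopf\<close> at \<open>z\<close> in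
  the direction \<open>h\<close>, so the gradient of \<open>v \<bullet> hopf z\<close> in
  \<open>z\<close> is \<open>- 2 i z v\<close>.\<close>

lemma inner_R3_of_quat_hopf_derivative:
  "v \<bullet> R3_of_quat (qcnj z \<odot> qi \<odot> h + qcnj h \<odot> qi \<odot> z) = - 2 * ((qi \<odot> z \<odot> quat_of_R3 v) \<bullet> h)"
  by (simp add: inner_vec_def sum_3 sum_quat_index algebra_simps)

text \<open>Turns the factor \<open>z u\<close> of the lifted equation into a multiple of
  \<open>i z\<close>, the form in which the \<open>z\<close>-gradient of the Hamiltonian contains
  the perturbing force.\<close>

lemma qmult_hopf: "z \<odot> hopf z = (norm z)\<^sup>2 *\<^sub>R (qi \<odot> z)"
  by (simp add: hopf_def qmult_assoc[symmetric] qmult_qcnj quat_linear_simps)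

section \<open>Behaviour at collisions\<close>

text \<open>\<open>B\<close> increases from 0, hence is positive, so \<open>r' = B / r\<close> makes
  \<open>r\<close> nondecreasing. Therefore \<open>M * r x\<close> bounds \<open>c'\<close> on all
  of \<open>(a, x)\<close>, and the mean value inequality applies. The factor \<open>x - a\<close>
  in addition to \<open>r x\<close> is what makes \<open>c / r\<close> vanish at the
  collision.\<close>

lemma norm_le_mult_distance_to_common_zero:
  fixes c :: "real \<Rightarrow> 'a::real_normed_vector" and r B :: "real \<Rightarrow> real"
  assumes cont: "continuous_on {a..b} c" "continuous_on {a..b} B" "continuous_on {a..b} r"
    and init: "c a = 0" "B a = 0"
    and c: "\<And>x. a < x \<Longrightarrow> x < b \<Longrightarrow> (c has_vector_derivative c' x) (at x)"
    and c': "\<And>x. a < x \<Longrightarrow> x < b \<Longrightarrow> norm (c' x) \<le> M * r x"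
    and B: "\<And>x. a < x \<Longrightarrow> x < b \<Longrightarrow> (B has_vector_derivative B' x) (at x)"
    and B': "\<And>x. a < x \<Longrightarrow> x < b \<Longrightarrow> B' x > 0"
    and r: "\<And>x. a < x \<Longrightarrow> x < b \<Longrightarrow> (r has_vector_derivative B x / r x) (at x)"
    and pos: "\<And>x. a < x \<Longrightarrow> x < b \<Longrightarrow> r x > 0"
    and M: "M \<ge> 0" and x: "a < x" "x < b"
  shows "norm (c x) \<le> M * r x * (x - a) \<and> B x > 0"
proof -
  have Bpos: "B y > 0" if "a < y" "y < b" for y
  proof -
    have "B a < B y"
    proof (rule DERIV_pos_imp_increasing_open[of a y B])
      fix w assume "a < w" "w < y"
      then show "\<exists>d. (B has_real_derivative d) (at w) \<and> d > 0"
        using B[of w] B'[of w] that unfolding has_real_derivative_iff_has_vector_derivative by auto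
    qed (use that cont(2) in \<open>auto intro: continuous_on_subset\<close>)
    then show ?thesis using init by simp
  qed
  have r_mono: "r y \<le> r x" if "a < y" "y \<le> x" for y
  proof (rule DERIV_nonneg_imp_increasing_open[of y x r])
    fix w assume "y < w" "w < x"
    then show "\<exists>d. (r has_real_derivative d) (at w) \<and> d \<ge> 0"
      using r[of w] Bpos[of w] pos[of w] that x
      unfolding has_real_derivative_iff_has_vector_derivative
      by (intro exI[of _ "B w / r w"]) auto
  qed (use that x cont(3) in \<open>auto intro: continuous_on_subset\<close>)
  have "norm (c x - c a) \<le> M * r x * x - M * r x * a"
  proof (rule differentiable_bound_general[of a x c "\<lambda>y. M * r x * y" c' "\<lambda>_. M * r x"])
    fix y assume y: "a < y" "y < x"
    have "M * r y \<le> M * r x" using r_mono y M by (intro mult_left_mono) auto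
    with c'[of y] y x show "norm (c' y) \<le> M * r x" by simp
    show "(c has_vector_derivative c' y) (at y)" using c y x by simp
    show "((\<lambda>y. M * r x * y) has_vector_derivative M * r x) (at y)"
      by (auto intro!: derivative_eq_intros)
  next
    show "continuous_on {a..x} c" by (rule continuous_on_subset[OF cont(1)]) (use x in auto)
  qed (use x in \<open>auto intro!: continuous_intros\<close>)
  then have "norm (c x) \<le> M * r x * (x - a)"
    by (simp add: init algebra_simps)
  with Bpos x show ?thesis by blast
qed

text \<open>\<sigma> is the parity of the number of points of \<open>Z\<close> between 0 and
  \<open>x\<close>, and \<kappa> is its value at \<open>T\<close> relative to 0. It becomes the sign
  of the radius.\<close>

lemma sign_changing_on_discrete:
  fixes Z :: "real set"
  assumes Z: "\<And>x. \<not> x islimpt Z" and per: "\<And>x. x + T \<in> Z \<longleftrightarrow> x \<in> Z"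
  obtains \<sigma> :: "real \<Rightarrow> real" and \<kappa> where
    "\<And>x. \<sigma> x = 1 \<or> \<sigma> x = -1" "\<kappa> = 1 \<or> \<kappa> = -1" "\<And>x. \<sigma> (x + T) = \<kappa> * \<sigma> x"
    "\<And>x. x \<notin> Z \<Longrightarrow> \<forall>\<^sub>F y in nhds x. \<sigma> y = \<sigma> x"
    "\<And>x. x \<in> Z \<Longrightarrow> \<forall>\<^sub>F y in at x. \<sigma> y = (if x < y then \<sigma> x else - \<sigma> x)"
proof -
  \<comment> \<open>Half-open intervals add without overlap, and a point of \<open>Z\<close> counts
    as soon as it is reached. Hence \<open>\<sigma> x\<close> at \<open>x \<in> Z\<close> is the
    value taken just to the right of \<open>x\<close>.\<close>
  define N where "N = (\<lambda>a b. card (Z \<inter> {a<..b}))"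
  define \<sigma> :: "real \<Rightarrow> real" where "\<sigma> x = (if 0 \<le> x then (-1) ^ N 0 x else (-1) ^ N x 0)" for x
  have fin: "finite (Z \<inter> {a<..b})" for a b
  proof (rule finite_subset)
    show "finite ({a..b} \<inter> Z)"
      using finite_not_islimpt_in_compact[of "{a..b}" Z] Z by blast
  qed auto
  have N_add: "N a c = N a b + N b c" if "a \<le> b" "b \<le> c" for a b c
  proof -
    have "Z \<inter> {a<..c} = (Z \<inter> {a<..b}) \<union> (Z \<inter> {b<..c})" using that by auto
    then show ?thesis unfolding N_def using fin by (simp only:) (rule card_Un_disjoint, auto)
  qed
  have sq: "(-1 :: real) ^ k * (-1) ^ k = 1" for k :: nat
    by (simp add: power_add[symmetric])
  have \<sigma>: "\<sigma> b = \<sigma> a * (-1) ^ N a b" if "a \<le> b" for a b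
  proof -
    consider "0 \<le> a" | "a < 0" "0 \<le> b" | "b < 0" using that by linarith
    then show ?thesis
    proof cases
      case 1
      then show ?thesis using N_add[of 0 a b] that by (simp add: \<sigma>_def power_add)
    next
      case 2
      then show ?thesis using N_add[of a 0 b] by (simp add: \<sigma>_def power_add mult.assoc[symmetric] sq)
    next
      case 3
      then show ?thesis using N_add[of a b 0] that
        by (simp add: \<sigma>_def power_add mult.assoc mult.commute)
    qed
  qed
  have pm: "\<sigma> x = 1 \<or> \<sigma> x = -1" for x
    by (simp add: \<sigma>_def) (metis neg_one_even_power neg_one_odd_power)
  have N_per: "N (a + T) (b + T) = N a b" for a b
  proof -
    have "Z \<inter> {a + T<..b + T} = (\<lambda>x. x + T) ` (Z \<inter> {a<..b})"
    proof (intro equalityI subsetI)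
      fix x assume "x \<in> Z \<inter> {a + T<..b + T}"
      then have "x - T \<in> Z \<inter> {a<..b}" using per[of "x - T"] by auto
      then show "x \<in> (\<lambda>x. x + T) ` (Z \<inter> {a<..b})" by force
    qed (use per in auto)
    then show ?thesis by (simp add: N_def card_image)
  qed
  \<comment> \<open>From \<open>a\<close> to \<open>b\<close> both factors change by the same sign
    \<open>(-1) ^ N a b\<close>.\<close>
  have per_le: "\<sigma> (b + T) * \<sigma> b = \<sigma> (a + T) * \<sigma> a" if "a \<le> b" for a b
  proof -
    have "\<sigma> (b + T) * \<sigma> b = (\<sigma> (a + T) * (-1) ^ N a b) * (\<sigma> a * (-1) ^ N a b)"
      using \<sigma>[of "a + T" "b + T"] \<sigma>[of a b] that by (simp add: N_per)
    also have "\<dots> = \<sigma> (a + T) * \<sigma> a * ((-1) ^ N a b * (-1) ^ N a b)" by (simp only: mult_ac)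
    finally show ?thesis by (simp add: sq)
  qed
  define \<kappa> where "\<kappa> = \<sigma> T * \<sigma> 0"
  have per_\<kappa>: "\<sigma> (x + T) * \<sigma> x = \<kappa>" for x
    using per_le[of 0 x] per_le[of x 0] by (cases "0 \<le> x") (auto simp: \<kappa>_def)
  have N1: "N a b = (if x \<in> Z then 1 else 0)"
    if "a < x" "x \<le> b" and off: "\<And>y. a < y \<Longrightarrow> y \<le> b \<Longrightarrow> y \<noteq> x \<Longrightarrow> y \<notin> Z" for a x b
  proof -
    have x: "x \<in> {a<..b}" using that(1,2) by simp
    have sub: "Z \<inter> {a<..b} \<subseteq> {x}"
    proof
      fix y assume "y \<in> Z \<inter> {a<..b}"
      then show "y \<in> {x}" using off[of y] by (cases "y = x") simp_all
    qed
    show ?thesis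
    proof (cases "x \<in> Z")
      case True
      with x sub have "Z \<inter> {a<..b} = {x}" by blast
      with True show ?thesis by (simp add: N_def)
    next
      case False
      with sub have "Z \<inter> {a<..b} = {}" by blast
      with False show ?thesis by (simp add: N_def)
    qed
  qed
  have N0: "N a b = 0" if "\<And>y. a < y \<Longrightarrow> y \<le> b \<Longrightarrow> y \<notin> Z" for a b
  proof -
    have "Z \<inter> {a<..b} = {}" using that by auto
    then show ?thesis by (simp add: N_def)
  qed
  have loc: "\<exists>d>0. \<forall>y. dist y x < d \<longrightarrow> y \<noteq> x \<longrightarrow> \<sigma> y = (if x < y \<or> x \<notin> Z then \<sigma> x else - \<sigma> x)" for x
  proof -
    obtain d where d: "d > 0" "\<And>y. y \<noteq> x \<Longrightarrow> dist y x < d \<Longrightarrow> y \<notin> Z"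
      using Z[of x] unfolding islimpt_approachable by blast
    have "\<sigma> y = (if x < y \<or> x \<notin> Z then \<sigma> x else - \<sigma> x)" if y: "dist y x < d" "y \<noteq> x" for y
    proof (cases "x < y")
      case True
      then have "N x y = 0" using y by (intro N0 d(2)) (auto simp: dist_real_def)
      then show ?thesis using True \<sigma>[of x y] by simp
    next
      case False
      then have "N y x = (if x \<in> Z then 1 else 0)" using y by (intro N1 d(2)) (auto simp: dist_real_def)
      then show ?thesis using False \<sigma>[of y x] by auto
    qed
    with d(1) show ?thesis by blast
  qed
  show ?thesis
  proof (rule that[of \<sigma> \<kappa>])
    show "\<kappa> = 1 \<or> \<kappa> = -1" using pm[of T] pm[of 0] by (auto simp: \<kappa>_def)
    show "\<sigma> (x + T) = \<kappa> * \<sigma> x" for x using per_\<kappa>[of x] pm[of x] by auto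
    show "\<forall>\<^sub>F y in nhds x. \<sigma> y = \<sigma> x" if "x \<notin> Z" for x
      using loc[of x] that unfolding eventually_nhds_metric by metis
    show "\<forall>\<^sub>F y in at x. \<sigma> y = (if x < y then \<sigma> x else - \<sigma> x)" if "x \<in> Z" for x
      using loc[of x] that unfolding eventually_at by (metis UNIV_I)
  qed (rule pm)
qed

section \<open>Kepler orbits with a continuous perturbing force\<close>

text \<open>
  \<open>f\<close> is the perturbing force along the orbit; \<open>n\<close> and \<open>h\<close> are the continuous extensions of
  direction and energy.  Nothing is assumed about \<open>v\<close> at collisions except periodicity.
\<close>

locale kepler_generalized_orbit =
  fixes u v f n :: "real \<Rightarrow> real^3" and h :: "real \<Rightarrow> real" and T :: real
  assumes T_pos: "T > 0"
    and isolated: "\<And>t. \<not> t islimpt {t. u t = 0}"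
    and cont_u: "continuous_on UNIV u" and cont_f: "continuous_on UNIV f"
    and cont_n: "continuous_on UNIV n" and cont_h: "continuous_on UNIV h"
    and u_periodic: "\<And>t. u (t + T) = u t" and v_periodic: "\<And>t. v (t + T) = v t"
    and deriv_u: "\<And>t. u t \<noteq> 0 \<Longrightarrow> (u has_vector_derivative v t) (at t)"
    and deriv_v: "\<And>t. u t \<noteq> 0 \<Longrightarrow> (v has_vector_derivative - (u t /\<^sub>R norm (u t) ^ 3) + f t) (at t)"
    and n_eq: "\<And>t. u t \<noteq> 0 \<Longrightarrow> n t = u t /\<^sub>R norm (u t)"
    and h_eq: "\<And>t. u t \<noteq> 0 \<Longrightarrow> h t = (norm (v t))\<^sup>2 / 2 - 1 / norm (u t)"
begin

definition r where "r t = norm (u t)"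
definition B where "B t = u t \<bullet> v t"
definition c where "c t = cross3 (u t) (v t)"
text \<open>The continuous part of \<open>B'\<close>: the energy gives
  \<open>|v|^2 = 2 h + 2 / r\<close>, the Kepler force contributes \<open>- 1 / r\<close>, and
  \<open>1 / r + k\<close> results.\<close>

definition k where "k t = 2 * h t + u t \<bullet> f t"
text \<open>At a collision \<open>q\<close> is \<open>0\<close> by the convention \<open>1 / 0 = 0\<close>; this is also its limit, see \<open>cont_q\<close>.\<close>

definition q where "q t = c t /\<^sub>R r t"

lemma r_nonneg [simp]: "r t \<ge> 0" by (simp add: r_def)
lemma r_pos: "u t \<noteq> 0 \<Longrightarrow> r t > 0" by (simp add: r_def)

lemma at_collision: "u t = 0 \<Longrightarrow> r t = 0 \<and> B t = 0 \<and> c t = 0 \<and> q t = 0"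
  by (simp add: r_def B_def c_def q_def)

text \<open>Lagrange's identity for \<open>u\<close> and \<open>v\<close>, with \<open>|v|^2\<close>
  eliminated through the energy. The right side is continuous and vanishes at collisions, so it
  controls \<open>B\<close> and \<open>c\<close> where \<open>v\<close> is unbounded.\<close>

lemma B_sq: "(B t)\<^sup>2 + (norm (c t))\<^sup>2 = 2 * r t + 2 * h t * (r t)\<^sup>2"
proof (cases "u t = 0")
  case False
  then have v: "(norm (v t))\<^sup>2 = 2 * h t + 2 / r t" using h_eq[of t] by (simp add: r_def)
  have "(r t * norm (v t))\<^sup>2 = 2 * r t + 2 * h t * (r t)\<^sup>2"
    unfolding power_mult_distrib v using r_pos[OF False] by (simp add: field_simps power2_eq_square)
  then show ?thesis using norm_cross_dot[of "u t" "v t"] by (simp add: r_def B_def c_def)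
qed (simp add: at_collision)

lemma cont_r: "continuous_on UNIV r" unfolding r_def by (intro continuous_intros cont_u)
lemma cont_k: "continuous_on UNIV k" unfolding k_def by (intro continuous_intros cont_u cont_f cont_h)

lemma deriv_r: "u t \<noteq> 0 \<Longrightarrow> (r has_vector_derivative B t / r t) (at t)"
  unfolding has_vector_derivative_def r_def B_def
  by (rule has_derivative_eq_rhs[OF has_derivative_compose[OF deriv_u[unfolded has_vector_derivative_def] has_derivative_norm]])
    (auto simp: sgn_div_norm inner_commute divide_inverse)

lemma deriv_B: "u t \<noteq> 0 \<Longrightarrow> (B has_vector_derivative 1 / r t + k t) (at t)"
proof -
  assume *: "u t \<noteq> 0"
  have "(B has_vector_derivative u t \<bullet> (- (u t /\<^sub>R norm (u t) ^ 3) + f t) + v t \<bullet> v t) (at t)"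
    unfolding B_def
    by (rule bounded_bilinear.has_vector_derivative[OF bounded_bilinear_inner deriv_u deriv_v]) fact+
  moreover have "v t \<bullet> v t = 2 * h t + 2 / r t"
    using h_eq[OF *] by (simp add: r_def dot_square_norm)
  moreover have "u t \<bullet> (u t /\<^sub>R norm (u t) ^ 3) = 1 / r t"
    using r_pos[OF *] by (simp add: r_def dot_square_norm power3_eq_cube power2_eq_square field_simps)
  ultimately show ?thesis by (simp add: k_def inner_diff_right add.assoc) (simp add: add.commute add.left_commute)
qed

text \<open>The central force exerts no torque; the torque of \<open>f\<close> is locally bounded by
  a multiple of \<open>r\<close>.\<close>

lemma deriv_c: "u t \<noteq> 0 \<Longrightarrow> (c has_vector_derivative cross3 (u t) (f t)) (at t)"
proof -
  assume *: "u t \<noteq> 0"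
  have bb: "bounded_bilinear cross3"
    using bilinear_cross bilinear_conv_bounded_bilinear by blast
  have "(c has_vector_derivative cross3 (u t) (- (u t /\<^sub>R norm (u t) ^ 3) + f t) + cross3 (v t) (v t)) (at t)"
    unfolding c_def by (rule bounded_bilinear.has_vector_derivative[OF bb deriv_u deriv_v]) fact+
  then show ?thesis
    by (simp add: Cross3.right_diff_distrib cross_mult_right)
qed

text \<open>The Kepler force is conservative, so only the power of \<open>f\<close> is left. It
  contains \<open>v\<close>, so the formula is confined to regular times.\<close>

lemma deriv_h: "u t \<noteq> 0 \<Longrightarrow> (h has_vector_derivative f t \<bullet> v t) (at t)"
proof -
  assume *: "u t \<noteq> 0"
  let ?w = "- (u t /\<^sub>R norm (u t) ^ 3) + f t"
  have "((\<lambda>t. (v t \<bullet> v t) / 2 - inverse (r t)) has_vector_derivative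
     (v t \<bullet> ?w + ?w \<bullet> v t) / 2 + B t / r t * inverse (r t ^ 2)) (at t)"
    using bounded_bilinear.has_vector_derivative[OF bounded_bilinear_inner deriv_v deriv_v, OF * *]
      deriv_r[OF *] r_pos[OF *]
    unfolding has_real_derivative_iff_has_vector_derivative[symmetric]
    by (auto intro!: derivative_eq_intros simp: power2_eq_square field_simps)
  moreover have "(v t \<bullet> ?w + ?w \<bullet> v t) / 2 + B t / r t * inverse (r t ^ 2) = f t \<bullet> v t"
  proof -
    have "v t \<bullet> ?w = v t \<bullet> f t - B t / r t ^ 3"
      by (simp add: B_def r_def inner_diff_right inner_commute divide_inverse)
    moreover have "?w \<bullet> v t = v t \<bullet> ?w" by (rule inner_commute)
    moreover have "B t / r t * inverse (r t ^ 2) = B t / r t ^ 3"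
      using r_pos[OF *] by (simp add: field_simps power3_eq_cube power2_eq_square)
    ultimately show ?thesis by (simp add: inner_commute diff_divide_distrib)
  qed
  ultimately have d: "((\<lambda>t. (v t \<bullet> v t) / 2 - inverse (r t)) has_vector_derivative f t \<bullet> v t) (at t)"
    by simp
  have "open {t. u t \<noteq> 0}"
    by (rule open_Collect_neq[OF cont_u continuous_on_const])
  then show ?thesis
  proof (rule has_vector_derivative_transform_within_open[OF d])
    fix x assume "x \<in> {t. u t \<noteq> 0}"
    then show "(v x \<bullet> v x) / 2 - inverse (r x) = h x"
      by (simp add: h_eq r_def dot_square_norm inverse_eq_divide)
  qed (use * in simp)
qed

lemma tendsto_at_of_cont: "continuous_on UNIV g \<Longrightarrow> g \<midarrow>t\<rightarrow> g t"
  by (simp add: continuous_on_def)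

lemma cont_B: "continuous_on UNIV B" and cont_c: "continuous_on UNIV c"
proof -
  let ?g = "\<lambda>t. sqrt (2 * r t + 2 * h t * (r t)\<^sup>2)"
  have g: "norm (B t) \<le> ?g t" "norm (c t) \<le> ?g t" for t
    using B_sq[of t] by (auto intro!: real_le_rsqrt) (metis le_add_same_cancel2 le_add_same_cancel1 zero_le_power2)+
  have "isCont B t \<and> isCont c t" for t
  proof (cases "u t = 0")
    case True
    have "continuous_on UNIV ?g" by (intro continuous_intros cont_r cont_h)
    then have "?g \<midarrow>t\<rightarrow> ?g t" by (rule tendsto_at_of_cont)
    then have g0: "?g \<midarrow>t\<rightarrow> 0" using at_collision[OF True] by simp
    have "B \<midarrow>t\<rightarrow> 0"
      by (rule Lim_null_comparison[OF always_eventually g0]) (use g in blast)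
    moreover have "c \<midarrow>t\<rightarrow> 0"
      by (rule Lim_null_comparison[OF always_eventually g0]) (use g in blast)
    ultimately show ?thesis using at_collision[OF True] by (simp add: isCont_def)
  next
    case False
    show ?thesis
      using has_vector_derivative_continuous[OF deriv_B[OF False]] has_vector_derivative_continuous[OF deriv_c[OF False]]
      by simp
  qed
  then show "continuous_on UNIV B" "continuous_on UNIV c"
    by (simp_all add: continuous_on_eq_continuous_at)
qed

text \<open>Near \<open>t0\<close> the quantity \<open>r B' = 1 + r k\<close> is close to 1, so
  \<open>B\<close> increases on each side of its zero \<open>t0\<close>. This gives the sign of
  \<open>B\<close> and allows \<open>norm_le_mult_distance_to_common_zero\<close> to be applied, on
  the left after time reversal. The first estimate serves \<open>q\<close>, the sign of
  \<open>B\<close> serves the radial velocity.\<close>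

lemma collision_estimates:
  assumes t0: "u t0 = 0"
  shows "\<exists>M. \<forall>\<^sub>F t in at t0. u t \<noteq> 0 \<and> norm (c t) \<le> M * r t * \<bar>t - t0\<bar> \<and> (if t0 < t then B t > 0 else B t < 0)"
proof -
  define M where "M = norm (f t0) + 1"
  have "(\<lambda>t. 1 + r t * k t) \<midarrow>t0\<rightarrow> 1 + r t0 * k t0"
    by (intro tendsto_at_of_cont continuous_intros cont_r cont_k)
  then have 1: "\<forall>\<^sub>F t in at t0. 1 + r t * k t > 0"
    by (rule order_tendstoD) (simp add: at_collision[OF t0])
  have "(\<lambda>t. norm (f t)) \<midarrow>t0\<rightarrow> norm (f t0)"
    by (intro tendsto_at_of_cont continuous_intros cont_f)
  then have 2: "\<forall>\<^sub>F t in at t0. norm (f t) < M"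
    by (rule order_tendstoD) (simp add: M_def)
  have 3: "\<forall>\<^sub>F t in at t0. u t \<noteq> 0"
    using isolated[of t0] by (simp add: islimpt_iff_eventually)
  from 1 2 3 have "\<forall>\<^sub>F t in at t0. 1 + r t * k t > 0 \<and> norm (f t) < M \<and> u t \<noteq> 0"
    by eventually_elim simp
  then obtain d where d: "d > 0" and near: "\<And>t. t \<noteq> t0 \<Longrightarrow> dist t t0 < d \<Longrightarrow> 1 + r t * k t > 0 \<and> norm (f t) < M \<and> u t \<noteq> 0"
    unfolding eventually_at by auto
  have M: "M \<ge> 0" by (simp add: M_def)
  have B': "1 / r t + k t > 0" if "t \<noteq> t0" "dist t t0 < d" for t
    using near[OF that] r_pos[of t] by (simp add: field_simps)
  have c': "norm (cross3 (u t) (f t)) \<le> M * r t" if "t \<noteq> t0" "dist t t0 < d" for t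
  proof -
    have "(norm (cross3 (u t) (f t)))\<^sup>2 \<le> (norm (u t) * norm (f t))\<^sup>2"
      using norm_cross_dot[of "u t" "f t"] by (smt (verit) zero_le_power2)
    then have "norm (cross3 (u t) (f t)) \<le> norm (u t) * norm (f t)"
      by (rule power2_le_imp_le) simp
    also have "\<dots> \<le> norm (u t) * M"
      using near[OF that] by (intro mult_left_mono) auto
    finally show ?thesis by (simp add: r_def mult.commute)
  qed
  have right: "norm (c t) \<le> M * r t * (t - t0) \<and> B t > 0" if t: "t0 < t" "t < t0 + d" for t
  proof (rule norm_le_mult_distance_to_common_zero[where a = t0 and b = "t0 + d" and c = c and B = B and r = r
      and c' = "\<lambda>t. cross3 (u t) (f t)" and B' = "\<lambda>t. 1 / r t + k t" and M = M])
    fix x assume "t0 < x" "x < t0 + d"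
    then have x: "x \<noteq> t0" "dist x t0 < d" by (auto simp: dist_real_def)
    then have "u x \<noteq> 0" using near by blast
    from deriv_c[OF this] deriv_B[OF this] deriv_r[OF this] r_pos[OF this] B'[OF x] c'[OF x]
    show "(c has_vector_derivative cross3 (u x) (f x)) (at x)"
      "(B has_vector_derivative 1 / r x + k x) (at x)"
      "(r has_vector_derivative B x / r x) (at x)" "r x > 0" "1 / r x + k x > 0"
      "norm (cross3 (u x) (f x)) \<le> M * r x"
      by blast+
  qed (use t M at_collision[OF t0] in \<open>auto intro: continuous_on_subset[OF cont_c] continuous_on_subset[OF cont_B] continuous_on_subset[OF cont_r]\<close>)
  have left: "norm (c t) \<le> M * r t * (t0 - t) \<and> B t < 0" if t: "t < t0" "t0 - d < t" for t
  proof -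
    have m: "(uminus has_vector_derivative - 1) (at x)" for x :: real
      using has_vector_derivative_minus[OF has_vector_derivative_id[of "at x"]] by simp
    have cm: "continuous_on S (\<lambda>x. g (- x))" if "continuous_on UNIV g" for g :: "real \<Rightarrow> 'x::real_normed_vector" and S
      by (rule continuous_on_compose2[OF that]) (auto intro: continuous_intros)
    \<comment> \<open>Time reversal keeps \<open>r\<close> and replaces \<open>B\<close> by
      \<open>- B (- x)\<close>, whose derivative is again positive.\<close>
    have "norm (c (- (- t))) \<le> M * r (- (- t)) * (- t - (- t0)) \<and> - B (- (- t)) > 0"
    proof (rule norm_le_mult_distance_to_common_zero[where a = "- t0" and b = "- t0 + d"
          and c = "\<lambda>x. c (- x)" and B = "\<lambda>x. - B (- x)" and r = "\<lambda>x. r (- x)"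
      and c' = "\<lambda>t. - cross3 (u (- t)) (f (- t))" and B' = "\<lambda>t. 1 / r (- t) + k (- t)" and M = M])
      fix x assume "- t0 < x" "x < - t0 + d"
      then have x: "- x \<noteq> t0" "dist (- x) t0 < d" by (auto simp: dist_real_def)
      then have ux: "u (- x) \<noteq> 0" using near by blast
      from r_pos[OF this] B'[OF x] c'[OF x]
      show "r (- x) > 0" "1 / r (- x) + k (- x) > 0"
        "norm (- cross3 (u (- x)) (f (- x))) \<le> M * r (- x)"
        by simp_all
      show "((\<lambda>x. c (- x)) has_vector_derivative - cross3 (u (- x)) (f (- x))) (at x)"
        using vector_diff_chain_at[OF m deriv_c[OF ux]] by (simp add: o_def)
      show "((\<lambda>x. - B (- x)) has_vector_derivative 1 / r (- x) + k (- x)) (at x)"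
        using has_vector_derivative_minus[OF vector_diff_chain_at[OF m deriv_B[OF ux]]] by (simp add: o_def add.commute)
      show "((\<lambda>x. r (- x)) has_vector_derivative - B (- x) / r (- x)) (at x)"
        using vector_diff_chain_at[OF m deriv_r[OF ux]] by (simp add: o_def)
    qed (use t M at_collision[OF t0] in \<open>auto intro!: continuous_intros cm cont_c cont_B cont_r\<close>)
    then show ?thesis by simp
  qed
  have "u t \<noteq> 0 \<and> norm (c t) \<le> M * r t * \<bar>t - t0\<bar> \<and> (if t0 < t then B t > 0 else B t < 0)"
    if "t \<noteq> t0" "dist t t0 < d" for t
    using right[of t] left[of t] near[OF that] that by (cases "t0 < t") (auto simp: dist_real_def abs_real_def)
  then show ?thesis
    unfolding eventually_at using d by (intro exI[of _ M] exI[of _ d]) auto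
qed

lemma cont_q: "continuous_on UNIV q"
proof (rule continuous_at_imp_continuous_on, rule ballI)
  fix t
  show "isCont q t"
  proof (cases "u t = 0")
    case True
    obtain M where M: "\<forall>\<^sub>F x in at t. u x \<noteq> 0 \<and> norm (c x) \<le> M * r x * \<bar>x - t\<bar> \<and> (if t < x then B x > 0 else B x < 0)"
      using collision_estimates[OF True] ..
    then have "\<forall>\<^sub>F x in at t. norm (q x) \<le> M * \<bar>x - t\<bar>"
      by eventually_elim (use r_pos in \<open>auto simp: q_def field_simps\<close>)
    moreover have "(\<lambda>x. M * \<bar>x - t\<bar>) \<midarrow>t\<rightarrow> M * \<bar>t - t\<bar>"
      by (intro tendsto_intros)
    ultimately have "q \<midarrow>t\<rightarrow> 0"
      by (intro Lim_null_comparison[of q]) auto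
    then show ?thesis using at_collision[OF True] by (simp add: isCont_def)
  next
    case False
    then show ?thesis unfolding q_def
      using cont_c cont_r r_pos[OF False]
      by (intro continuous_intros) (auto simp: continuous_on_eq_continuous_at)
  qed
qed

end

section \<open>Fictitious time and signed radius\<close>

context kepler_generalized_orbit
begin

lemma regular_nearby: "\<forall>\<^sub>F t in at t0. u t \<noteq> 0"
  using isolated[of t0] by (simp add: islimpt_iff_eventually)

lemma open_regular: "open {t. u t \<noteq> 0}"
  by (rule open_Collect_neq[OF cont_u continuous_on_const])

lemma h_periodic: "h (t + T) = h t"
proof -
  have off: "h (t + T) = h t" if "t \<notin> {t. u t = 0}" for t
    using that by (simp add: h_eq u_periodic v_periodic)
  show ?thesis
  proof (rule eq_if_eq_off_discrete[OF _ cont_h isolated off])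
    show "continuous_on UNIV (\<lambda>t. h (t + T))"
      by (rule continuous_on_compose2[OF cont_h]) (auto intro!: continuous_intros)
  qed
qed

lemma n_periodic: "n (t + T) = n t"
proof -
  have off: "n (t + T) = n t" if "t \<notin> {t. u t = 0}" for t
    using that by (simp add: n_eq u_periodic)
  show ?thesis
  proof (rule eq_if_eq_off_discrete[OF _ cont_n isolated off])
    show "continuous_on UNIV (\<lambda>t. n (t + T))"
      by (rule continuous_on_compose2[OF cont_n]) (auto intro!: continuous_intros)
  qed
qed

lemma norm_n: "norm (n t) = 1"
proof -
  have "norm (n t) = 1" if "t \<notin> {t. u t = 0}" for t
    using that by (simp add: n_eq)
  then show ?thesis
    using eq_if_eq_off_discrete[of "\<lambda>t. norm (n t)" "\<lambda>_. 1" "{t. u t = 0}"] isolated cont_n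
    by (auto intro: continuous_intros)
qed

lemma u_eq_r_n: "u t = r t *\<^sub>R n t"
  by (cases "u t = 0") (auto simp: at_collision n_eq r_def)

lemma q_periodic: "q (t + T) = q t"
  by (simp add: q_def c_def r_def u_periodic v_periodic)

lemma fictitious_time:
  obtains \<theta> s :: "real \<Rightarrow> real" and S where
    "homeomorphism UNIV UNIV \<theta> s" "S > 0" "\<And>x. \<theta> (x + S) = \<theta> x + T"
    "\<And>x. (\<theta> has_vector_derivative r (\<theta> x)) (at x)"
proof -
  obtain G where G: "\<And>t. (G has_vector_derivative k t) (at t)"
    using antiderivative_on_line[OF cont_k] by metis
  have cont_G: "continuous_on UNIV G"
    using has_vector_derivative_continuous[OF G] by (simp add: continuous_on_eq_continuous_at)
  \<comment> \<open>Off the collisions \<open>B' = 1/r + k\<close>, so the integral of \<open>1/r\<close> converges at collisions because \<open>B\<close> is continuous there.\<close>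
  define s where "s t = B t - G t" for t
  have cont_s: "continuous_on UNIV s"
    unfolding s_def by (intro continuous_intros cont_B cont_G)
  have ds: "(s has_vector_derivative 1 / r t) (at t)" if "u t \<noteq> 0" for t
    unfolding s_def using has_vector_derivative_diff[OF deriv_B[OF that] G] by simp
  have mono_regular: "s a < s b" if "a < b" "\<And>t. a < t \<Longrightarrow> t < b \<Longrightarrow> u t \<noteq> 0" for a b
  proof (rule DERIV_pos_imp_increasing_open[OF that(1)])
    fix t assume "a < t" "t < b"
    then have "u t \<noteq> 0" using that by blast
    with ds[OF this] r_pos[OF this] show "\<exists>d. (s has_real_derivative d) (at t) \<and> d > 0"
      unfolding has_real_derivative_iff_has_vector_derivative by (intro exI[of _ "1 / r t"]) simp
  qed (rule continuous_on_subset[OF cont_s], simp)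
  \<comment> \<open>At the finitely many collisions \<open>1 / r\<close> has the default value 0, so
    the integrand is nonnegative throughout.\<close>
  have le: "s a \<le> s b" if "a \<le> b" for a b
  proof -
    have "finite ({a..b} \<inter> {t. u t = 0})"
      using finite_not_islimpt_in_compact[of "{a..b}" "{t. u t = 0}"] isolated by blast
    then have "((\<lambda>t. 1 / r t) has_integral s b - s a) {a..b}"
      using that
      by (rule fundamental_theorem_of_calculus_strong) (use ds continuous_on_subset[OF cont_s] in auto)
    then have "0 \<le> s b - s a" by (rule has_integral_nonneg) simp
    then show ?thesis by simp
  qed
  \<comment> \<open>Strictness comes from a short interval to the right of \<open>a\<close> with no
    collision in its interior.\<close>
  have less: "s a < s b" if "a < b" for a b
  proof -
    obtain d where d: "d > 0" "\<And>t. t \<noteq> a \<Longrightarrow> dist t a < d \<Longrightarrow> u t \<noteq> 0"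
      using regular_nearby[of a] unfolding eventually_at by auto
    define m where "m = min b (a + d)"
    have "a < m" "m \<le> b" using that d by (auto simp: m_def)
    have "s a < s m"
    proof (rule mono_regular[OF \<open>a < m\<close>])
      show "u t \<noteq> 0" if "a < t" "t < m" for t
        using that by (intro d(2)) (auto simp: m_def dist_real_def)
    qed
    also have "s m \<le> s b" by (rule le[OF \<open>m \<le> b\<close>])
    finally show ?thesis .
  qed
  define S where "S = s T - s 0"
  have S: "S > 0" using less[OF T_pos] by (simp add: S_def)
  have s_per: "s (t + T) = s t + S" for t
  proof -
    let ?g = "\<lambda>t. s (t + T) - s t"
    have "?g t = ?g 0"
    proof (rule constant_if_zero_derivative_off_discrete[of ?g "{t. u t = 0}" t 0, OF _ isolated])
      show "continuous_on UNIV ?g"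
        by (intro continuous_intros continuous_on_compose2[OF cont_s]) (auto intro: cont_s)
      fix t assume "t \<notin> {t. u t = 0}"
      then have u: "u t \<noteq> 0" "u (t + T) \<noteq> 0" by (auto simp: u_periodic)
      have "((\<lambda>t. t + T) has_vector_derivative 1) (at t)"
        by (auto intro!: derivative_eq_intros)
      from vector_diff_chain_at[OF this ds[OF u(2)]]
      have "((\<lambda>t. s (t + T)) has_vector_derivative 1 / r t) (at t)"
        by (simp add: o_def r_def u_periodic)
      from has_vector_derivative_diff[OF this ds[OF u(1)]]
      show "(?g has_vector_derivative 0) (at t)" by simp
    qed
    then show ?thesis by (simp add: S_def)
  qed
  \<comment> \<open>Whole periods make \<open>s\<close> unbounded in both directions, so the
    intermediate value theorem gives surjectivity.\<close>
  have s_nat: "s (real m * T) = s 0 + real m * S" "s (- real m * T) = s 0 - real m * S" for m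
  proof (induction m)
    case (Suc m)
    { case 1 show ?case using Suc s_per[of "real m * T"] by (simp add: algebra_simps) }
    { case 2 show ?case using Suc s_per[of "- real (Suc m) * T"] by (simp add: algebra_simps) }
  qed auto
  have surj: "\<exists>t. s t = y" for y
  proof -
    obtain m where m: "real m * S > \<bar>y - s 0\<bar>" using ex_less_of_nat_mult[OF S] by blast
    have "s (- real m * T) \<le> y" "y \<le> s (real m * T)" using m unfolding s_nat by linarith+
    moreover have "- real m * T \<le> real m * T" using T_pos by simp
    ultimately show ?thesis
      using IVT'[of s "- real m * T" y "real m * T"] continuous_on_subset[OF cont_s] by blast
  qed
  have mono: "strict_mono s" using less by (simp add: strict_mono_def)
  then have inj: "inj s" by (rule strict_mono_imp_inj_on)
  define \<theta> where "\<theta> = inv s"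
  have \<theta>s: "\<theta> (s t) = t" for t using inj by (simp add: \<theta>_def)
  have s\<theta>: "s (\<theta> x) = x" for x using surj by (simp add: \<theta>_def f_inv_into_f rangeI) (metis f_inv_into_f rangeI)
  have cont_\<theta>: "continuous_on UNIV \<theta>"
  proof (rule continuous_onI_mono)
    have "range \<theta> = UNIV" using \<theta>s by (metis surjI)
    then show "open (range \<theta>)" by simp
    show "\<theta> x \<le> \<theta> y" if "x \<le> y" for x y
      using that mono by (metis s\<theta> strict_mono_less_eq)
  qed
  have "inj \<theta>" using s\<theta> by (metis injI)
  from not_islimpt_vimage_inj[OF cont_\<theta> this isolated] have D: "\<not> x islimpt {x. u (\<theta> x) = 0}" for x
    by simp
  \<comment> \<open>At a collision \<open>s\<close> has infinite slope, but its inverse has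
    derivative \<open>r = 0\<close> there, obtained from continuity of both sides.\<close>
  have d\<theta>: "(\<theta> has_vector_derivative r (\<theta> x)) (at x)" for x
  proof (rule has_vector_derivative_across_discrete[OF cont_\<theta> _ D])
    show "continuous_on UNIV (\<lambda>x. r (\<theta> x))"
      by (rule continuous_on_compose2[OF cont_r cont_\<theta>]) simp
    fix x assume "x \<notin> {x. u (\<theta> x) = 0}"
    then have u: "u (\<theta> x) \<noteq> 0" by simp
    have "(\<theta> has_real_derivative inverse (1 / r (\<theta> x))) (at x)"
      by (rule has_field_derivative_inverse_basic[where f = s and t = UNIV])
        (use ds[OF u] r_pos[OF u] s\<theta> cont_\<theta> in \<open>auto simp: has_real_derivative_iff_has_vector_derivative continuous_on_eq_continuous_at\<close>)
    then show "(\<theta> has_vector_derivative r (\<theta> x)) (at x)"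
      by (simp add: has_real_derivative_iff_has_vector_derivative)
  qed
  show ?thesis
  proof (rule that[of \<theta> s S])
    show "homeomorphism UNIV UNIV \<theta> s"
      using \<theta>s s\<theta> cont_\<theta> cont_s unfolding homeomorphism_def by (auto simp: image_iff) (metis)+
    show "\<theta> (x + S) = \<theta> x + T" for x
      using s_per[of "\<theta> x"] \<theta>s s\<theta> by metis
  qed (use S d\<theta> in auto)
qed

lemma regular_near: "u t \<noteq> 0 \<Longrightarrow> \<forall>\<^sub>F x in nhds t. u x \<noteq> 0"
  using eventually_nhds_in_open[OF open_regular] by auto

text \<open>\<open>\<rho>'\<close> is the derivative in the fictitious time, hence the quotients by
  \<open>r\<close> in the last two clauses. Its square comes from dividing \<open>B_sq\<close> by
  \<open>4 r\<close>; the resulting expression stays continuous at a collision and equals 1/2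
  there.\<close>

lemma signed_radius:
  obtains \<rho> \<rho>' :: "real \<Rightarrow> real" and \<kappa> where
    "\<kappa> = 1 \<or> \<kappa> = -1" "\<And>t. \<rho> (t + T) = \<kappa> * \<rho> t" "\<And>t. \<rho>' (t + T) = \<kappa> * \<rho>' t"
    "continuous_on UNIV \<rho>" "continuous_on UNIV \<rho>'" "\<And>t. (\<rho> t)\<^sup>2 = r t"
    "\<And>t. (\<rho>' t)\<^sup>2 = 1 / 2 + h t * r t / 2 - (norm (q t))\<^sup>2 * r t / 4" "\<And>t. \<rho> t * \<rho>' t = B t / 2"
    "\<And>t. u t \<noteq> 0 \<Longrightarrow> (\<rho> has_vector_derivative \<rho>' t / r t) (at t)"
    "\<And>t. u t \<noteq> 0 \<Longrightarrow> (\<rho>' has_vector_derivative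
        \<rho> t * (h t / 2 + u t \<bullet> f t / 2 + (norm (q t))\<^sup>2 / 4) / r t) (at t)"
proof -
  have per: "t + T \<in> {t. u t = 0} \<longleftrightarrow> t \<in> {t. u t = 0}" for t by (simp add: u_periodic)
  obtain \<sigma> :: "real \<Rightarrow> real" and \<kappa> where \<sigma>: "\<And>x. \<sigma> x = 1 \<or> \<sigma> x = -1"
    and \<kappa>: "\<kappa> = 1 \<or> \<kappa> = -1" and \<sigma>_per: "\<And>x. \<sigma> (x + T) = \<kappa> * \<sigma> x"
    and reg: "\<And>x. x \<notin> {t. u t = 0} \<Longrightarrow> \<forall>\<^sub>F y in nhds x. \<sigma> y = \<sigma> x"
    and coll: "\<And>x. x \<in> {t. u t = 0} \<Longrightarrow> \<forall>\<^sub>F y in at x. \<sigma> y = (if x < y then \<sigma> x else - \<sigma> x)"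
    by (rule sign_changing_on_discrete[OF isolated per], rule that)
  have \<sigma>_reg: "\<forall>\<^sub>F y in nhds x. \<sigma> y = \<sigma> x" if "u x \<noteq> 0" for x
    using reg[of x] that by simp
  have \<sigma>_coll: "\<forall>\<^sub>F y in at x. \<sigma> y = (if x < y then \<sigma> x else - \<sigma> x)" if "u x = 0" for x
    using coll[of x] that by simp
  define \<rho> where "\<rho> t = \<sigma> t * sqrt (r t)" for t
  \<comment> \<open>At a collision \<open>B / (2 \<rho>)\<close> has the form 0/0. The value
    inserted is its limit: the square is 1/2 and the sign is the one of \<rho> just after the
    collision.\<close>
  define \<rho>' where "\<rho>' t = (if u t = 0 then \<sigma> t * sqrt (1 / 2) else B t / (2 * \<rho> t))" for t
  define E where "E t = 1 / 2 + h t * r t / 2 - (norm (q t))\<^sup>2 * r t / 4" for t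
  have \<sigma>2: "\<sigma> t * \<sigma> t = 1" for t using \<sigma>[of t] by auto
  have \<rho>2: "(\<rho> t)\<^sup>2 = r t" for t
    using \<sigma>2[of t] by (simp add: \<rho>_def power_mult_distrib) (simp add: power2_eq_square)
  have \<rho>0: "\<rho> t \<noteq> 0" if "u t \<noteq> 0" for t
    using \<rho>2[of t] r_pos[OF that] by auto
  have \<rho>\<rho>': "\<rho> t * \<rho>' t = B t / 2" for t
    using at_collision[of t] \<rho>0[of t] by (simp add: \<rho>'_def \<rho>_def)
  have qc: "(norm (c t))\<^sup>2 = (norm (q t))\<^sup>2 * (r t)\<^sup>2" for t
    using at_collision[of t] r_pos[of t]
    by (cases "u t = 0") (auto simp: q_def power_mult_distrib power2_eq_square field_simps)
  have \<rho>'2: "(\<rho>' t)\<^sup>2 = E t" for t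
  proof (cases "u t = 0")
    case True
    then show ?thesis using at_collision[OF True] \<sigma>2[of t]
      by (simp add: \<rho>'_def E_def power_mult_distrib) (simp add: power2_eq_square)
  next
    case False
    then have "(\<rho>' t)\<^sup>2 = (B t)\<^sup>2 / (4 * r t)"
      by (simp add: \<rho>'_def power_divide power_mult_distrib \<rho>2)
    also have "\<dots> = E t"
      using B_sq[of t] r_pos[OF False] unfolding qc E_def
      by (simp add: field_simps power2_eq_square)
    finally show ?thesis .
  qed
  have d\<rho>: "(\<rho> has_vector_derivative \<rho>' t / r t) (at t)" if u: "u t \<noteq> 0" for t
  proof -
    have "((\<lambda>x. \<sigma> t * sqrt (r x)) has_real_derivative \<sigma> t * (B t / r t * (inverse (sqrt (r t)) / 2))) (at t)"
      using deriv_r[OF u] r_pos[OF u] unfolding has_real_derivative_iff_has_vector_derivative[symmetric]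
      by (auto intro!: derivative_eq_intros simp: mult_ac)
    moreover have "\<sigma> t * (B t / r t * (inverse (sqrt (r t)) / 2)) = \<rho>' t / r t"
      using u r_pos[OF u] \<sigma>[of t] by (auto simp: \<rho>'_def \<rho>_def field_simps)
    moreover have "\<forall>\<^sub>F x in nhds t. \<sigma> t * sqrt (r x) = \<rho> x"
      using \<sigma>_reg[OF u] by eventually_elim (simp add: \<rho>_def)
    ultimately have "(\<rho> has_real_derivative \<rho>' t / r t) (at t)"
      using DERIV_cong_ev[OF refl _ refl, of "\<lambda>x. \<sigma> t * sqrt (r x)" \<rho> t "\<rho>' t / r t"] by simp
    then show ?thesis by (simp add: has_real_derivative_iff_has_vector_derivative)
  qed
  have d\<rho>': "(\<rho>' has_vector_derivative
        \<rho> t * (h t / 2 + u t \<bullet> f t / 2 + (norm (q t))\<^sup>2 / 4) / r t) (at t)" if u: "u t \<noteq> 0" for t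
  proof -
    let ?d = "((1 / r t + k t) * (2 * \<rho> t) - B t * (2 * (\<rho>' t / r t))) / (2 * \<rho> t * (2 * \<rho> t))"
    have "((\<lambda>x. B x / (2 * \<rho> x)) has_real_derivative ?d) (at t)"
      using deriv_B[OF u] d\<rho>[OF u] \<rho>0[OF u] unfolding has_real_derivative_iff_has_vector_derivative[symmetric]
      by (auto intro!: derivative_eq_intros)
    \<comment> \<open>Eliminating \<open>B\<close> through \<open>\<rho> \<rho>'\<close> and then
      the square of \<open>\<rho>'\<close> through \<open>E\<close> cancels the two singular terms
      \<open>2 / r\<close>.\<close>
    moreover have "?d = \<rho> t * (h t / 2 + u t \<bullet> f t / 2 + (norm (q t))\<^sup>2 / 4) / r t"
    proof -
      have N: "B t * (2 * (\<rho>' t / r t)) = 4 * E t * \<rho> t / r t"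
      proof -
        have "B t = 2 * (\<rho> t * \<rho>' t)" using \<rho>\<rho>'[of t] by simp
        then show ?thesis unfolding \<rho>'2[of t, symmetric] by (simp add: power2_eq_square)
      qed
      have D: "2 * \<rho> t * (2 * \<rho> t) = 4 * r t"
        using \<rho>2[of t] by (simp add: power2_eq_square)
      show ?thesis
        unfolding N D E_def k_def using r_pos[OF u] by (simp add: field_simps)
    qed
    moreover have "\<forall>\<^sub>F x in nhds t. B x / (2 * \<rho> x) = \<rho>' x"
      using regular_near[OF u] by eventually_elim (simp add: \<rho>'_def)
    ultimately show ?thesis
      using DERIV_cong_ev[OF refl _ refl, of "\<lambda>x. B x / (2 * \<rho> x)" \<rho>' t ?d]
      by (simp add: has_real_derivative_iff_has_vector_derivative)
  qed
  have cont_\<rho>: "isCont \<rho> t" for t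
  proof (cases "u t = 0")
    case True
    have "(\<lambda>x. sqrt (r x)) \<midarrow>t\<rightarrow> sqrt (r t)"
      by (intro tendsto_at_of_cont continuous_intros cont_r)
    moreover have "norm (\<rho> x) = sqrt (r x)" for x using \<sigma>[of x] by (auto simp: \<rho>_def)
    ultimately have "\<rho> \<midarrow>t\<rightarrow> 0"
      using at_collision[OF True] by (simp add: tendsto_norm_zero_iff[of \<rho>, symmetric] del: real_norm_def)
    then show ?thesis using at_collision[OF True] by (simp add: isCont_def \<rho>_def)
  qed (rule has_vector_derivative_continuous[OF d\<rho>])
  have cont_\<rho>': "isCont \<rho>' t" for t
  proof (cases "u t = 0")
    case True
    obtain M where "\<forall>\<^sub>F x in at t. u x \<noteq> 0 \<and> norm (c x) \<le> M * r x * \<bar>x - t\<bar> \<and> (if t < x then B x > 0 else B x < 0)"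
      using collision_estimates[OF True] ..
    \<comment> \<open>Before the collision \<open>B\<close> and \<rho> both have the sign opposite
      to the one after it, so their quotient has the sign \<open>\<sigma> t\<close> on both sides
      and is determined by its square \<open>E\<close>.\<close>
    with \<sigma>_coll[OF True] have ev: "\<forall>\<^sub>F x in at t. \<sigma> t * sqrt (E x) = \<rho>' x"
    proof eventually_elim
      case (elim x)
      then have "\<sigma> t * \<rho>' x \<ge> 0"
        using \<sigma>[of t] r_pos[of x] by (auto simp: \<rho>'_def \<rho>_def divide_simps split: if_splits)
      moreover have "(\<sigma> t * \<rho>' x)\<^sup>2 = E x"
        using \<sigma>2[of t] by (simp add: power_mult_distrib \<rho>'2) (simp add: power2_eq_square)
      ultimately have "sqrt (E x) = \<sigma> t * \<rho>' x" using real_sqrt_unique by blast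
      then show ?case using \<sigma>2[of t] by (simp add: mult.assoc[symmetric])
    qed
    have "continuous_on UNIV (\<lambda>x. \<sigma> t * sqrt (E x))"
      unfolding E_def by (intro continuous_intros cont_h cont_r cont_q) simp_all
    then have "(\<lambda>x. \<sigma> t * sqrt (E x)) \<midarrow>t\<rightarrow> \<sigma> t * sqrt (E t)"
      by (rule tendsto_at_of_cont)
    moreover have "\<sigma> t * sqrt (E t) = \<rho>' t"
      using True at_collision[OF True] by (simp add: E_def \<rho>'_def)
    ultimately show ?thesis
      unfolding isCont_def using Lim_transform_eventually[OF _ ev] by simp
  qed (rule has_vector_derivative_continuous[OF d\<rho>'])
  have per: "\<rho> (t + T) = \<kappa> * \<rho> t" "\<rho>' (t + T) = \<kappa> * \<rho>' t" for t
    using \<kappa> by (auto simp: \<rho>_def \<rho>'_def \<sigma>_per r_def B_def u_periodic v_periodic)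
  show ?thesis
    by (rule that[of \<kappa> \<rho> \<rho>'])
      (use \<kappa> per cont_\<rho> cont_\<rho>' \<rho>2 \<rho>'2 \<rho>\<rho>' d\<rho> d\<rho>' in \<open>simp_all add: E_def continuous_on_eq_continuous_at\<close>)
qed

end

section \<open>The lift to quaternions\<close>

context kepler_generalized_orbit
begin

text \<open>The Hamiltonian solution before the potential enters: with \<open>w = 4 z'\<close>, the
  formula for the norm of \<open>z'\<close> becomes \<open>K = 0\<close>, the vanishing real part
  becomes \<open>BL = 0\<close>, and the second-order equation becomes the equation for
  \<open>w\<close>.\<close>

lemma ks_lift:
  obtains \<theta> s S z z' g where
    "homeomorphism UNIV UNIV \<theta> s" "S > 0" "\<And>x. \<theta> (x + S) = \<theta> x + T"
    "\<And>x. (\<theta> has_vector_derivative r (\<theta> x)) (at x)"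
    "\<And>x. (z has_vector_derivative z' x) (at x)"
    "\<And>x. (z' has_vector_derivative
       z x \<odot> ((h (\<theta> x) / 2) *\<^sub>R qone - (1 / 2) *\<^sub>R (quat_of_R3 (u (\<theta> x)) \<odot> quat_of_R3 (f (\<theta> x))))) (at x)"
    "\<And>x. hopf (z x) = quat_of_R3 (u (\<theta> x))" "\<And>x. (norm (z x))\<^sup>2 = r (\<theta> x)"
    "\<And>x. qRe (qcnj (z x) \<odot> qi \<odot> z' x) = 0"
    "\<And>x. (norm (z' x))\<^sup>2 = 1 / 2 + h (\<theta> x) * r (\<theta> x) / 2"
    "cmod g = 1" "\<And>x. z (x + S) = quat_of_complex g \<odot> z x" "\<And>x. z' (x + S) = quat_of_complex g \<odot> z' x"
proof -
  obtain \<theta> s S where hom: "homeomorphism UNIV UNIV \<theta> s" and S: "S > 0"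
    and \<theta>_per: "\<And>x. \<theta> (x + S) = \<theta> x + T"
    and d\<theta>: "\<And>x. (\<theta> has_vector_derivative r (\<theta> x)) (at x)"
    by (rule fictitious_time, rule that)
  obtain \<rho> \<rho>' :: "real \<Rightarrow> real" and \<kappa> where \<kappa>: "\<kappa> = 1 \<or> \<kappa> = -1"
    and \<rho>_per: "\<And>t. \<rho> (t + T) = \<kappa> * \<rho> t" "\<And>t. \<rho>' (t + T) = \<kappa> * \<rho>' t"
    and cont_\<rho>: "continuous_on UNIV \<rho>" "continuous_on UNIV \<rho>'" and \<rho>2: "\<And>t. (\<rho> t)\<^sup>2 = r t"
    and \<rho>'2: "\<And>t. (\<rho>' t)\<^sup>2 = 1 / 2 + h t * r t / 2 - (norm (q t))\<^sup>2 * r t / 4"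
    and \<rho>\<rho>': "\<And>t. \<rho> t * \<rho>' t = B t / 2"
    and d\<rho>: "\<And>t. u t \<noteq> 0 \<Longrightarrow> (\<rho> has_vector_derivative \<rho>' t / r t) (at t)"
    and d\<rho>': "\<And>t. u t \<noteq> 0 \<Longrightarrow> (\<rho>' has_vector_derivative
        \<rho> t * (h t / 2 + u t \<bullet> f t / 2 + (norm (q t))\<^sup>2 / 4) / r t) (at t)"
    by (rule signed_radius, rule that)
  have cont_\<theta>: "continuous_on UNIV \<theta>" using hom by (simp add: homeomorphism_def)
  have inj: "inj \<theta>" by (metis UNIV_I hom homeomorphism_apply1 injI)
  have cont: "continuous_on UNIV (\<lambda>x. F (\<theta> x))" if "continuous_on UNIV F" for F :: "real \<Rightarrow> 'x::topological_space"
    by (rule continuous_on_compose2[OF that cont_\<theta>]) simp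
  from not_islimpt_vimage_inj[OF cont_\<theta> inj isolated] have D: "\<not> x islimpt {x. u (\<theta> x) = 0}" for x
    by simp
  have chain: "((\<lambda>x. F (\<theta> x)) has_vector_derivative r (\<theta> x) *\<^sub>R F') (at x)"
    if "(F has_vector_derivative F') (at (\<theta> x))" for F :: "real \<Rightarrow> 'x::real_normed_vector" and F' x
    using vector_diff_chain_at[OF d\<theta> that] by (simp add: o_def)
  let ?U = "\<lambda>x. quat_of_R3 (u (\<theta> x))" and ?N = "\<lambda>x. quat_of_R3 (n (\<theta> x))"
  \<comment> \<open>The angular velocity \<open>q\<close> is halved because it acts on
    \<open>n\<close> through a commutator, which doubles it; see \<open>Na\<close>.\<close>
  define a where "a x = quat_of_R3 (- (1/2) *\<^sub>R q (\<theta> x))" for x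
  have cont_a: "continuous_on UNIV a"
    unfolding a_def by (intro continuous_on_quat_of_R3 continuous_intros cont_q[THEN cont])

  \<comment> \<open>Off collisions \<open>n' = v - (B / r^2) u\<close>, the part of \<open>v\<close>
    orthogonal to \<open>u\<close>. The expansion of \<open>(u x v) x u\<close> rewrites it as a
    cross product with the continuous \<open>q\<close>.\<close>
  have dn: "((\<lambda>x. n (\<theta> x)) has_vector_derivative cross3 (q (\<theta> x)) (n (\<theta> x))) (at x)" for x
  proof (rule has_vector_derivative_across_discrete[OF _ _ D])
    show "continuous_on UNIV (\<lambda>x. n (\<theta> x))"
      "continuous_on UNIV (\<lambda>x. cross3 (q (\<theta> x)) (n (\<theta> x)))"
      by (intro continuous_on_cross cont_q[THEN cont] cont_n[THEN cont])+
    fix x assume "x \<notin> {x. u (\<theta> x) = 0}"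
    then have u: "u (\<theta> x) \<noteq> 0" by simp
    let ?t = "\<theta> x"
    note rp = r_pos[OF u]
    have "((\<lambda>t. (1 / r t) *\<^sub>R u t) has_vector_derivative (1 / r ?t) *\<^sub>R v ?t + (- (B ?t / r ?t / (r ?t)\<^sup>2)) *\<^sub>R u ?t) (at ?t)"
    proof (rule has_vector_derivative_scaleR[OF _ deriv_u[OF u]])
      show "((\<lambda>t. 1 / r t) has_real_derivative - (B ?t / r ?t / (r ?t)\<^sup>2)) (at ?t)"
        using deriv_r[OF u] rp unfolding has_real_derivative_iff_has_vector_derivative[symmetric]
        by (auto intro!: derivative_eq_intros simp: power2_eq_square)
    qed
    then have "(n has_vector_derivative (1 / r ?t) *\<^sub>R v ?t + (- (B ?t / r ?t / (r ?t)\<^sup>2)) *\<^sub>R u ?t) (at ?t)"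
      by (rule has_vector_derivative_transform_within_open[OF _ open_regular])
        (use u in \<open>auto simp: n_eq r_def divide_inverse\<close>)
    from chain[OF this] have "((\<lambda>x. n (\<theta> x)) has_vector_derivative v ?t - (B ?t / (r ?t)\<^sup>2) *\<^sub>R u ?t) (at x)"
      using rp by (simp add: scaleR_add_right scaleR_diff_right)
    moreover have "cross3 (q ?t) (n ?t) = v ?t - (B ?t / (r ?t)\<^sup>2) *\<^sub>R u ?t"
    proof -
      have "cross3 (c ?t) (u ?t) = (r ?t)\<^sup>2 *\<^sub>R v ?t - B ?t *\<^sub>R u ?t"
        using Lagrange[of "u ?t" "u ?t" "v ?t"] cross_skew[of "c ?t" "u ?t"]
        by (simp add: c_def B_def r_def power2_norm_eq_inner)
      moreover have "cross3 (q ?t) (n ?t) = (1 / (r ?t)\<^sup>2) *\<^sub>R cross3 (c ?t) (u ?t)"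
        using u by (simp add: q_def n_eq cross_mult_left cross_mult_right r_def[symmetric] divide_inverse power2_eq_square)
      ultimately show ?thesis using rp by (simp add: scaleR_diff_right)
    qed
    ultimately show "((\<lambda>x. n (\<theta> x)) has_vector_derivative cross3 (q (\<theta> x)) (n (\<theta> x))) (at x)"
      by simp
  qed

  obtain \<zeta>0 where \<zeta>0: "norm \<zeta>0 = 1" "hopf \<zeta>0 = ?N 0"
    using hopf_onto_sphere[OF norm_n] by blast
  \<comment> \<open>\<open>prod_left\<close> at \<open>a x\<close> is right multiplication by
    \<open>a x\<close>, the coefficient operator of the equation for \<zeta>.\<close>
  have cont_A: "continuous_on UNIV (\<lambda>x. bounded_bilinear.prod_left (\<odot>) (a x))"
    using bounded_linear.continuous_on[OF bounded_bilinear.bounded_linear_prod_left[OF bounded_bilinear_qmult] cont_a] .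
  obtain \<zeta> where \<zeta>_init: "\<zeta> 0 = \<zeta>0" and d\<zeta>: "\<And>x. (\<zeta> has_vector_derivative \<zeta> x \<odot> a x) (at x)"
    using linear_ode_solution[OF cont_A, of \<zeta>0]
    unfolding bounded_bilinear.prod_left.rep_eq[OF bounded_bilinear_qmult] by blast
  have cont_\<zeta>: "continuous_on UNIV \<zeta>"
    using has_vector_derivative_continuous[OF d\<zeta>] by (simp add: continuous_on_eq_continuous_at)
  have a_cnj: "qcnj (a x) = - a x" for x unfolding a_def by (rule qcnj_quat_of_R3)
  have const: "G x = G y" if "\<And>x. (G has_vector_derivative 0) (at x)" for G :: "real \<Rightarrow> quat" and x y
    using constant_if_zero_derivative_off_discrete[of G "{}"] that
    by (auto simp: continuous_on_eq_continuous_at intro: has_vector_derivative_continuous)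

  \<comment> \<open>Since \<open>a\<close> is imaginary, the two terms of the product rule cancel;
    \<zeta> keeps unit length.\<close>
  have "\<zeta> x \<odot> qcnj (\<zeta> x) = \<zeta> 0 \<odot> qcnj (\<zeta> 0)" for x
  proof (rule const)
    fix x
    have "((\<lambda>x. \<zeta> x \<odot> qcnj (\<zeta> x)) has_vector_derivative
       \<zeta> x \<odot> qcnj (\<zeta> x \<odot> a x) + (\<zeta> x \<odot> a x) \<odot> qcnj (\<zeta> x)) (at x)"
      by (intro qmult_derivative_intros d\<zeta>)
    then show "((\<lambda>x. \<zeta> x \<odot> qcnj (\<zeta> x)) has_vector_derivative 0) (at x)"
      by (simp add: qcnj_mult a_cnj quat_linear_simps qmult_assoc)
  qed
  then have "(norm (\<zeta> x))\<^sup>2 *\<^sub>R qone = (norm \<zeta>0)\<^sup>2 *\<^sub>R qone" for x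
    by (simp add: qmult_qcnj \<zeta>_init)
  then have norm_\<zeta>: "norm (\<zeta> x) = 1" for x
    using \<zeta>0(1) by (simp add: quat_eq_iff power2_eq_1_iff) (metis norm_ge_zero not_one_le_zero le_minus_one_simps(3))
  have \<zeta>\<zeta>: "qcnj (\<zeta> x) \<odot> \<zeta> x = qone" "\<zeta> x \<odot> qcnj (\<zeta> x) = qone" for x
    by (simp_all add: qmult_qcnj norm_\<zeta>)

  have Na: "a x \<odot> ?N x - ?N x \<odot> a x + quat_of_R3 (cross3 (q (\<theta> x)) (n (\<theta> x))) = 0" for x
    by (simp add: a_def quat_linear_simps quat_of_R3_mult inner_commute cross_skew[of "n (\<theta> x)"]
       scaleR_add_right scaleR_diff_right)
  \<comment> \<open>The conserved value is \<open>i\<close> by the choice of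
    \<open>\<zeta>0\<close>; solving for \<open>n\<close> then says that \<zeta> lies over
    \<open>n\<close> in the Hopf fibration.\<close>
  have "\<zeta> x \<odot> (?N x \<odot> qcnj (\<zeta> x)) = \<zeta> 0 \<odot> (?N 0 \<odot> qcnj (\<zeta> 0))" for x
  proof (rule const)
    fix x
    have "((\<lambda>x. \<zeta> x \<odot> (?N x \<odot> qcnj (\<zeta> x))) has_vector_derivative
       \<zeta> x \<odot> (?N x \<odot> qcnj (\<zeta> x \<odot> a x) + quat_of_R3 (cross3 (q (\<theta> x)) (n (\<theta> x))) \<odot> qcnj (\<zeta> x))
         + (\<zeta> x \<odot> a x) \<odot> (?N x \<odot> qcnj (\<zeta> x))) (at x)"
      by (intro qmult_derivative_intros d\<zeta> dn)
    moreover have "\<zeta> x \<odot> (?N x \<odot> qcnj (\<zeta> x \<odot> a x) + quat_of_R3 (cross3 (q (\<theta> x)) (n (\<theta> x))) \<odot> qcnj (\<zeta> x))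
         + (\<zeta> x \<odot> a x) \<odot> (?N x \<odot> qcnj (\<zeta> x))
       = \<zeta> x \<odot> ((a x \<odot> ?N x - ?N x \<odot> a x + quat_of_R3 (cross3 (q (\<theta> x)) (n (\<theta> x)))) \<odot> qcnj (\<zeta> x))"
      by (simp add: qcnj_mult a_cnj quat_linear_simps qmult_assoc)
    ultimately show "((\<lambda>x. \<zeta> x \<odot> (?N x \<odot> qcnj (\<zeta> x))) has_vector_derivative 0) (at x)"
      unfolding Na by (simp add: bounded_bilinear.zero_left[OF bounded_bilinear_qmult] bounded_bilinear.zero_right[OF bounded_bilinear_qmult])
  qed
  moreover have "\<zeta> 0 \<odot> (?N 0 \<odot> qcnj (\<zeta> 0)) = qi"
  proof -
    have "\<zeta> 0 \<odot> (?N 0 \<odot> qcnj (\<zeta> 0)) = (\<zeta> 0 \<odot> qcnj (\<zeta> 0)) \<odot> (qi \<odot> (\<zeta> 0 \<odot> qcnj (\<zeta> 0)))"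
      unfolding \<zeta>0(2)[symmetric] \<zeta>_init hopf_def qmult_assoc ..
    then show ?thesis by (simp add: \<zeta>\<zeta>)
  qed
  ultimately have conj: "\<zeta> x \<odot> (?N x \<odot> qcnj (\<zeta> x)) = qi" for x by metis
  have hopf_\<zeta>: "hopf (\<zeta> x) = ?N x" for x
  proof -
    have "hopf (\<zeta> x) = (qcnj (\<zeta> x) \<odot> \<zeta> x) \<odot> (?N x \<odot> (qcnj (\<zeta> x) \<odot> \<zeta> x))"
      unfolding hopf_def conj[of x, symmetric] qmult_assoc ..
    then show ?thesis by (simp add: \<zeta>\<zeta>)
  qed

  define z where "z x = \<rho> (\<theta> x) *\<^sub>R \<zeta> x" for x
  define z' where "z' x = \<rho>' (\<theta> x) *\<^sub>R \<zeta> x + \<rho> (\<theta> x) *\<^sub>R (\<zeta> x \<odot> a x)" for x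
  let ?F = "\<lambda>x. z x \<odot> ((h (\<theta> x) / 2) *\<^sub>R qone - (1 / 2) *\<^sub>R (?U x \<odot> quat_of_R3 (f (\<theta> x))))"
  have cont_z: "continuous_on UNIV z" and cont_z': "continuous_on UNIV z'"
    unfolding z_def z'_def
    by (intro continuous_intros continuous_on_qmult cont_\<rho>[THEN cont] cont_\<zeta> cont_a)+
  have cont_F: "continuous_on UNIV ?F"
    by (intro continuous_intros continuous_on_qmult continuous_on_quat_of_R3 cont_z
        cont_h[THEN cont] cont_u[THEN cont] cont_f[THEN cont]) simp
  have dz_reg: "(z has_vector_derivative z' x) (at x)" and dz'_reg: "(z' has_vector_derivative ?F x) (at x)"
    if u: "u (\<theta> x) \<noteq> 0" for x
  proof -
    let ?t = "\<theta> x"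
    note rp = r_pos[OF u]
    have 1: "((\<lambda>x. \<rho> (\<theta> x)) has_real_derivative \<rho>' ?t) (at x)"
      using chain[OF d\<rho>[OF u]] rp by (simp add: has_real_derivative_iff_has_vector_derivative)
    have 2: "((\<lambda>x. \<rho>' (\<theta> x)) has_real_derivative \<rho> ?t * (h ?t / 2 + u ?t \<bullet> f ?t / 2 + (norm (q ?t))\<^sup>2 / 4)) (at x)"
      using chain[OF d\<rho>'[OF u]] rp by (simp add: has_real_derivative_iff_has_vector_derivative)
    show "(z has_vector_derivative z' x) (at x)"
      using has_vector_derivative_scaleR[OF 1 d\<zeta>] unfolding z_def z'_def by (simp add: add.commute)
    \<comment> \<open>The factor \<open>B / r\<close> is unbounded near collisions;
      \<open>\<rho>b\<close> below removes it after multiplication by \<rho>.\<close>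
    have dq: "((\<lambda>x. q (\<theta> x)) has_vector_derivative cross3 (u ?t) (f ?t) - (B ?t / r ?t) *\<^sub>R q ?t) (at x)"
    proof -
      have "((\<lambda>t. (1 / r t) *\<^sub>R c t) has_vector_derivative (1 / r ?t) *\<^sub>R cross3 (u ?t) (f ?t) + (- (B ?t / r ?t / (r ?t)\<^sup>2)) *\<^sub>R c ?t) (at ?t)"
      proof (rule has_vector_derivative_scaleR[OF _ deriv_c[OF u]])
        show "((\<lambda>t. 1 / r t) has_real_derivative - (B ?t / r ?t / (r ?t)\<^sup>2)) (at ?t)"
          using deriv_r[OF u] rp unfolding has_real_derivative_iff_has_vector_derivative[symmetric]
          by (auto intro!: derivative_eq_intros simp: power2_eq_square)
      qed
      moreover have "(\<lambda>t. (1 / r t) *\<^sub>R c t) = q" by (rule ext) (simp add: q_def divide_inverse)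
      ultimately have "(q has_vector_derivative (1 / r ?t) *\<^sub>R cross3 (u ?t) (f ?t) + (- (B ?t / r ?t / (r ?t)\<^sup>2)) *\<^sub>R c ?t) (at ?t)"
        by simp
      moreover have "(B ?t / r ?t) *\<^sub>R q ?t = (r ?t * (B ?t / r ?t / (r ?t)\<^sup>2)) *\<^sub>R c ?t"
        using rp by (simp add: q_def power2_eq_square divide_inverse)
      ultimately show ?thesis
        using chain[of q _ x] rp by (fastforce simp: scaleR_add_right scaleR_diff_right)
    qed
    define b where "b = quat_of_R3 (- (1/2) *\<^sub>R (cross3 (u ?t) (f ?t) - (B ?t / r ?t) *\<^sub>R q ?t))"
    have da: "(a has_vector_derivative b) (at x)"
      unfolding a_def b_def
      by (intro qmult_derivative_intros bounded_linear.has_vector_derivative[OF bounded_linear_scaleR_right] dq)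
    have "(z' has_vector_derivative
       \<rho>' ?t *\<^sub>R (\<zeta> x \<odot> a x) + (\<rho> ?t * (h ?t / 2 + u ?t \<bullet> f ?t / 2 + (norm (q ?t))\<^sup>2 / 4)) *\<^sub>R \<zeta> x
       + (\<rho> ?t *\<^sub>R (\<zeta> x \<odot> b + (\<zeta> x \<odot> a x) \<odot> a x) + \<rho>' ?t *\<^sub>R (\<zeta> x \<odot> a x))) (at x)"
      unfolding z'_def
      by (intro has_vector_derivative_add has_vector_derivative_scaleR 1 2 d\<zeta> da qmult_derivative_intros)
    moreover have "\<rho>' ?t *\<^sub>R (\<zeta> x \<odot> a x) + (\<rho> ?t * (h ?t / 2 + u ?t \<bullet> f ?t / 2 + (norm (q ?t))\<^sup>2 / 4)) *\<^sub>R \<zeta> x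
       + (\<rho> ?t *\<^sub>R (\<zeta> x \<odot> b + (\<zeta> x \<odot> a x) \<odot> a x) + \<rho>' ?t *\<^sub>R (\<zeta> x \<odot> a x)) = ?F x"
    \<comment> \<open>The \<open>B / r\<close> term of \<open>\<rho> b\<close> equals
      \<open>- 2 \<rho>' a\<close> and cancels the cross terms of the product rule;
      \<open>a a\<close> cancels \<open>|q|^2 / 4\<close> from the radial equation. What remains,
      \<open>h / 2 + u \<bullet> f / 2 - (u x f) / 2\<close>, is
      \<open>h / 2 - (u f) / 2\<close>.\<close>
    proof -
      have aa: "a x \<odot> a x = - ((norm (q ?t))\<^sup>2 / 4) *\<^sub>R qone"
        unfolding a_def quat_of_R3_mult by (simp add: power2_norm_eq_inner cross_mult_left cross_mult_right) (simp add: quat_eq_iff)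
      have \<rho>b: "\<rho> ?t *\<^sub>R b = - (\<rho> ?t / 2) *\<^sub>R quat_of_R3 (cross3 (u ?t) (f ?t)) - (2 * \<rho>' ?t) *\<^sub>R a x"
      proof -
        have "\<rho> ?t * (B ?t / r ?t) = 2 * \<rho>' ?t"
        proof -
          have "B ?t = 2 * (\<rho> ?t * \<rho>' ?t)" using \<rho>\<rho>'[of ?t] by simp
          then have "\<rho> ?t * B ?t = 2 * \<rho>' ?t * (\<rho> ?t)\<^sup>2" by (simp add: power2_eq_square)
          then show ?thesis using rp by (simp add: \<rho>2)
        qed
        then show ?thesis
          unfolding b_def a_def by (simp add: quat_linear_simps scaleR_diff_right)
      qed
      have "\<rho>' ?t *\<^sub>R (\<zeta> x \<odot> a x) + (\<rho> ?t * (h ?t / 2 + u ?t \<bullet> f ?t / 2 + (norm (q ?t))\<^sup>2 / 4)) *\<^sub>R \<zeta> x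
         + (\<rho> ?t *\<^sub>R (\<zeta> x \<odot> b + (\<zeta> x \<odot> a x) \<odot> a x) + \<rho>' ?t *\<^sub>R (\<zeta> x \<odot> a x))
        = \<zeta> x \<odot> ((2 * \<rho>' ?t) *\<^sub>R a x + (\<rho> ?t * (h ?t / 2 + u ?t \<bullet> f ?t / 2 + (norm (q ?t))\<^sup>2 / 4)) *\<^sub>R qone
           + \<rho> ?t *\<^sub>R b + \<rho> ?t *\<^sub>R (a x \<odot> a x))"
        by (simp only: quat_linear_simps qmult_assoc qone_mult scaleR_add_right scaleR_add_left mult_2 add_ac)
      also have "\<dots> = \<zeta> x \<odot> (\<rho> ?t *\<^sub>R ((h ?t / 2) *\<^sub>R qone - (1 / 2) *\<^sub>R (?U x \<odot> quat_of_R3 (f ?t))))"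
        unfolding \<rho>b aa quat_of_R3_mult
        by (simp add: scaleR_add_right scaleR_diff_right scaleR_add_left distrib_left mult_ac)
          (simp add: add_diff_eq diff_diff_eq2)
      also have "\<dots> = ?F x" by (simp add: z_def quat_linear_simps scaleR_diff_right mult.commute)
      finally show ?thesis .
    qed
    ultimately show "(z' has_vector_derivative ?F x) (at x)" by simp
  qed
  have dz: "(z has_vector_derivative z' x) (at x)" for x
    by (rule has_vector_derivative_across_discrete[OF cont_z cont_z' D]) (use dz_reg in simp)
  have dz': "(z' has_vector_derivative ?F x) (at x)" for x
    by (rule has_vector_derivative_across_discrete[OF cont_z' cont_F D]) (use dz'_reg in simp)
  have hopf_z: "hopf (z x) = ?U x" for x
    unfolding z_def hopf_scaleR hopf_\<zeta> \<rho>2 u_eq_r_n[of "\<theta> x"] by (simp only: quat_linear_simps)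
  have norm_z: "(norm (z x))\<^sup>2 = r (\<theta> x)" for x
    by (simp add: z_def norm_\<zeta> \<rho>2)
  have cq: "c t \<bullet> n t = 0" for t
  proof -
    have "c t \<bullet> n t = 0" if "u t \<noteq> 0" using that by (simp add: n_eq c_def dot_cross_self)
    then show ?thesis using at_collision[of t] by (cases "u t = 0") auto
  qed
  \<comment> \<open>The radial part contributes a multiple of the imaginary \<open>n\<close>; the
    rest has the real part of \<open>n a\<close>, zero because \<open>q\<close> is orthogonal to
    \<open>n\<close>.\<close>
  have bl: "qRe (qcnj (z x) \<odot> qi \<odot> z' x) = 0" for x
  proof -
    have "qcnj (z x) \<odot> qi \<odot> z' x = \<rho> (\<theta> x) *\<^sub>R (\<rho>' (\<theta> x) *\<^sub>R hopf (\<zeta> x) + \<rho> (\<theta> x) *\<^sub>R (hopf (\<zeta> x) \<odot> a x))"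
    proof -
      have "qcnj (z x) = \<rho> (\<theta> x) *\<^sub>R qcnj (\<zeta> x)" by (simp add: z_def quat_eq_iff)
      then show ?thesis by (simp add: z'_def quat_linear_simps hopf_def qmult_assoc scaleR_add_right mult.commute)
    qed
    moreover have "(?N x \<odot> a x) $ 0 = 0"
      using cq[of "\<theta> x"] unfolding a_def quat_of_R3_mult by (simp add: q_def inner_commute)
    ultimately show ?thesis unfolding hopf_\<zeta> by (simp add: qRe_def del: qmult_nth)
  qed
  \<comment> \<open>The rotational part \<open>r |q|^2 / 4\<close> restores the term subtracted in
    the square of \<open>\<rho>'\<close>.\<close>
  have norm_z': "(norm (z' x))\<^sup>2 = 1 / 2 + h (\<theta> x) * r (\<theta> x) / 2" for x
  proof -
    have "z' x = \<zeta> x \<odot> (\<rho>' (\<theta> x) *\<^sub>R qone + \<rho> (\<theta> x) *\<^sub>R a x)"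
      by (simp add: z'_def quat_linear_simps)
    then have "norm (z' x) = norm (\<rho>' (\<theta> x) *\<^sub>R qone + \<rho> (\<theta> x) *\<^sub>R a x)"
      by (simp add: norm_qmult norm_\<zeta>)
    moreover have "(norm (\<rho>' (\<theta> x) *\<^sub>R qone + \<rho> (\<theta> x) *\<^sub>R a x))\<^sup>2
        = (\<rho>' (\<theta> x))\<^sup>2 + (\<rho> (\<theta> x))\<^sup>2 * ((norm (q (\<theta> x)))\<^sup>2 / 4)"
      unfolding norm_quat_sq norm_R3_sq a_def by (simp add: power2_eq_square algebra_simps add_divide_distrib)
    ultimately show ?thesis by (simp add: \<rho>2 \<rho>'2)
  qed

  have a_per: "a (x + S) = a x" for x by (simp add: a_def \<theta>_per q_periodic)
  \<comment> \<open>\<zeta> and its shift by \<open>S\<close> solve the same equation, whose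
    coefficient acts from the right, so they differ by a constant left factor. Both lie over the
    same \<open>n\<close>, so this factor fixes \<open>i\<close> under \<open>hopf\<close> and
    belongs to the circle.\<close>
  define g0 where "g0 = \<zeta> S \<odot> qcnj (\<zeta> 0)"
  have "\<zeta> (x + S) \<odot> qcnj (\<zeta> x) = \<zeta> (0 + S) \<odot> qcnj (\<zeta> 0)" for x
  proof (rule const)
    fix x
    have "((\<lambda>x. x + S) has_vector_derivative 1) (at x)"
      by (auto intro!: derivative_eq_intros)
    from vector_diff_chain_at[OF this d\<zeta>]
    have "((\<lambda>x. \<zeta> (x + S)) has_vector_derivative \<zeta> (x + S) \<odot> a x) (at x)" by (simp add: o_def a_per)
    then have "((\<lambda>x. \<zeta> (x + S) \<odot> qcnj (\<zeta> x)) has_vector_derivative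
       \<zeta> (x + S) \<odot> qcnj (\<zeta> x \<odot> a x) + (\<zeta> (x + S) \<odot> a x) \<odot> qcnj (\<zeta> x)) (at x)"
      by (intro qmult_derivative_intros d\<zeta>)
    then show "((\<lambda>x. \<zeta> (x + S) \<odot> qcnj (\<zeta> x)) has_vector_derivative 0) (at x)"
      by (simp add: qcnj_mult a_cnj quat_linear_simps qmult_assoc)
  qed
  then have g0: "\<zeta> (x + S) \<odot> qcnj (\<zeta> x) = g0" for x by (simp add: g0_def)
  have \<zeta>_per: "\<zeta> (x + S) = g0 \<odot> \<zeta> x" for x
  proof -
    have "\<zeta> (x + S) = (\<zeta> (x + S) \<odot> qcnj (\<zeta> x)) \<odot> \<zeta> x"
      by (simp add: qmult_assoc \<zeta>\<zeta>)
    then show ?thesis by (simp only: g0)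
  qed
  have "norm g0 = 1" by (simp add: g0_def norm_qmult norm_\<zeta>)
  moreover have "hopf g0 = qi"
  proof -
    have "hopf g0 = qcnj (qcnj (\<zeta> 0)) \<odot> hopf (\<zeta> S) \<odot> qcnj (\<zeta> 0)"
      unfolding g0_def hopf_qmult ..
    also have "hopf (\<zeta> S) = ?N 0" using hopf_\<zeta>[of S] \<theta>_per[of 0] by (simp add: n_periodic)
    also have "qcnj (qcnj (\<zeta> 0)) = \<zeta> 0" by (simp add: quat_eq_iff)
    finally show ?thesis using conj[of 0] by (simp add: qmult_assoc)
  qed
  ultimately obtain g where g: "cmod g = 1" "g0 = quat_of_complex g"
    by (rule hopf_stabilizer_of_qi)
  \<comment> \<open>The sign acquired by \<rho> over a period is absorbed into the circle
    element.\<close>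
  have \<kappa>g: "quat_of_complex (of_real \<kappa> * g) = \<kappa> *\<^sub>R quat_of_complex g" by (simp add: quat_eq_iff)
  show ?thesis
  proof (rule that[OF hom S \<theta>_per d\<theta> dz dz' hopf_z norm_z bl norm_z'])
    show "cmod (of_real \<kappa> * g) = 1" using \<kappa> g(1) by (auto simp: norm_mult)
    show "z (x + S) = quat_of_complex (of_real \<kappa> * g) \<odot> z x" for x
      unfolding \<kappa>g z_def \<theta>_per \<rho>_per \<zeta>_per g(2) by (simp add: quat_linear_simps mult.commute)
    show "z' (x + S) = quat_of_complex (of_real \<kappa> * g) \<odot> z' x" for x
      unfolding \<kappa>g z'_def \<theta>_per \<rho>_per \<zeta>_per g(2) a_per
      by (simp add: quat_linear_simps qmult_assoc scaleR_add_right mult.commute)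
  qed
qed

end

section \<open>Derivatives of the regularized Hamiltonian\<close>

lemma smooth_onD:
  assumes "smooth_on S F"
  obtains F' where "\<And>x. x \<in> S \<Longrightarrow> (F has_derivative F' x) (at x within S)"
    "\<And>v. continuous_on S (\<lambda>x. F' x v)"
proof -
  have "Ck_on (Suc 0) S F" using assms by (auto simp: smooth_on_def)
  then show ?thesis using that by auto
qed

text \<open>The coordinate formula reduces continuity of the gradient to continuity of directional
  derivatives.\<close>

lemma gradient_eqI:
  fixes F :: "'a::euclidean_space \<Rightarrow> real"
  assumes "(F has_derivative L) (at x)"
  shows "gradient F x = (\<Sum>i\<in>Basis. L i *\<^sub>R i)" "L v = v \<bullet> gradient F x"
proof -
  interpret L: bounded_linear L using assms by (rule has_derivative_bounded_linear)
  let ?d = "\<Sum>i\<in>Basis. L i *\<^sub>R i"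
  have L: "L v = v \<bullet> ?d" for v
  proof -
    have "L v = L (\<Sum>i\<in>Basis. (v \<bullet> i) *\<^sub>R i)" by (simp add: euclidean_representation)
    also have "\<dots> = (\<Sum>i\<in>Basis. (v \<bullet> i) * L i)" by (simp add: L.sum L.scaleR)
    finally show ?thesis by (simp add: inner_sum_right mult.commute)
  qed
  have "GDERIV F x :> ?d"
    unfolding gderiv_def by (rule has_derivative_eq_rhs[OF assms ext[OF L]])
  moreover have "d = ?d" if "GDERIV F x :> d" for d
  proof -
    have "(\<lambda>v. v \<bullet> d) = L"
      using that assms unfolding gderiv_def by (rule has_derivative_unique)
    then have "v \<bullet> d = v \<bullet> ?d" for v
      unfolding L[symmetric] by (rule fun_cong)
    then show ?thesis using vector_eq_ldot[of d ?d] by blast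
  qed
  ultimately show g: "gradient F x = ?d" unfolding gradient_def by (rule the_equality)
  show "L v = v \<bullet> gradient F x" unfolding g by (rule L)
qed

lemma norm_add_axis_sq: "(norm (w + y *\<^sub>R axis l 1 :: quat))\<^sup>2 = (norm w)\<^sup>2 + 2 * y * w $ l + y\<^sup>2"
  unfolding power2_norm_eq_inner
  by (simp only: inner_add_left inner_add_right inner_scaleR_left inner_scaleR_right inner_axis' inner_axis)
    (simp add: power2_eq_square distrib_left)

section \<open>The potential at a fixed parameter and the partial derivatives of the
  Hamiltonian\<close>

locale periodic_potential =
  fixes T \<epsilon>\<^sub>0 \<epsilon> :: real and \<U> :: "(real^3) set" and U :: "real \<Rightarrow> real^3 \<Rightarrow> real \<Rightarrow> real"
  assumes open_\<U>: "open \<U>"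
    and smooth: "smooth_on (UNIV \<times> \<U> \<times> {0..\<epsilon>\<^sub>0}) (\<lambda>(t, x, e). U t x e)"
    and periodic: "\<And>t x e. x \<in> \<U> \<Longrightarrow> e \<in> {0..\<epsilon>\<^sub>0} \<Longrightarrow> U (t + T) x e = U t x e"
    and \<epsilon>: "\<epsilon> \<in> {0..\<epsilon>\<^sub>0}"
begin

definition "U_t t x = deriv (\<lambda>t. U t x \<epsilon>) t"
definition "U_x t x = gradient (\<lambda>x. U t x \<epsilon>) x"

lemma derivative_U:
  assumes "x \<in> \<U>"
  shows "((\<lambda>p. U (fst p) (snd p) \<epsilon>) has_derivative (\<lambda>p. fst p * U_t t x + snd p \<bullet> U_x t x)) (at (t, x))"
    and "\<And>c. continuous_on UNIV c \<Longrightarrow> range c \<subseteq> \<U> \<Longrightarrow> continuous_on UNIV (\<lambda>t. U_t t (c t))"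
    and "\<And>c. continuous_on UNIV c \<Longrightarrow> range c \<subseteq> \<U> \<Longrightarrow> continuous_on UNIV (\<lambda>t. U_x t (c t))"
proof -
  let ?S = "UNIV \<times> \<U> \<times> {0..\<epsilon>\<^sub>0}"
  obtain F' where F': "\<And>p. p \<in> ?S \<Longrightarrow> ((\<lambda>(t, x, e). U t x e) has_derivative F' p) (at p within ?S)"
    and cont: "\<And>v. continuous_on ?S (\<lambda>p. F' p v)"
    using smooth_onD[OF smooth] by blast
  define L where "L t x = (\<lambda>p::real \<times> (real^3). F' (t, x, \<epsilon>) (fst p, snd p, 0))" for t x
  have L: "((\<lambda>p. U (fst p) (snd p) \<epsilon>) has_derivative L t x) (at (t, x))" if "x \<in> \<U>" for t x
  proof -
    \<comment> \<open>\<epsilon> may be an endpoint of the parameter interval, so the smoothness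
      hypothesis gives a derivative within \<open>?S\<close> only. The slice \<open>?j\<close> stays
      in \<open>?S\<close> and has an open domain, where the derivative becomes
      unrestricted.\<close>
    let ?j = "\<lambda>p::real \<times> (real^3). (fst p, snd p, \<epsilon>)"
    have o: "open (UNIV \<times> \<U> :: (real \<times> (real^3)) set)" using open_\<U> by (intro open_Times) auto
    have "(?j has_derivative (\<lambda>p. (fst p, snd p, 0))) (at (t, x) within UNIV \<times> \<U>)"
      by (auto intro!: derivative_eq_intros)
    moreover have "((\<lambda>(t, x, e). U t x e) has_derivative F' (t, x, \<epsilon>)) (at (?j (t, x)) within ?j ` (UNIV \<times> \<U>))"
      using F'[of "(t, x, \<epsilon>)"] that \<epsilon> by (auto elim!: has_derivative_subset)
    ultimately have "((\<lambda>p. case ?j p of (t, x, e) \<Rightarrow> U t x e) has_derivative (\<lambda>p. F' (t, x, \<epsilon>) (fst p, snd p, 0))) (at (t, x) within UNIV \<times> \<U>)"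
      by (rule has_derivative_in_compose)
    then show ?thesis using at_within_open[of "(t, x)", OF _ o] that by (simp add: L_def)
  qed
  have L_t: "((\<lambda>t. U t x \<epsilon>) has_real_derivative L t x (1, 0)) (at t)" if "x \<in> \<U>" for t x
  proof -
    interpret bounded_linear "L t x" using L[OF that] by (rule has_derivative_bounded_linear)
    have "((\<lambda>t. (t, x)) has_derivative (\<lambda>h. (h, 0))) (at t)"
      by (auto intro!: derivative_eq_intros)
    from has_derivative_compose[OF this L[OF that]]
    have "((\<lambda>t. U t x \<epsilon>) has_derivative (\<lambda>h. L t x (h, 0))) (at t)" by simp
    moreover have "(\<lambda>h. L t x (h, 0)) = (*) (L t x (1, 0))"
    proof
      show "L t x (h, 0) = L t x (1, 0) * h" for h
        using scaleR[of h "(1, 0)"] by (simp only: scaleR_Pair scaleR_zero_right real_scaleR_def mult_1_right mult_1_left mult.commute)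
    qed
    ultimately show ?thesis by (simp only: has_field_derivative_def)
  qed
  have L_x: "((\<lambda>x. U t x \<epsilon>) has_derivative (\<lambda>h. L t x (0, h))) (at x)" if "x \<in> \<U>" for t x
  proof -
    have "((\<lambda>x. (t, x)) has_derivative (\<lambda>h. (0, h))) (at x)"
      by (auto intro!: derivative_eq_intros)
    from has_derivative_compose[OF this L[OF that]] show ?thesis by simp
  qed
  have U_t: "U_t t x = L t x (1, 0)" if "x \<in> \<U>" for t x
    unfolding U_t_def by (rule DERIV_imp_deriv[OF L_t[OF that]])
  note U_x = gradient_eqI[OF L_x, folded U_x_def]
  have "L t x p = fst p * U_t t x + snd p \<bullet> U_x t x" for p
  proof -
    interpret bounded_linear "L t x" using L[OF assms] by (rule has_derivative_bounded_linear)
    have "L t x p = L t x (fst p *\<^sub>R (1, 0) + (0, snd p))" by simp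
    also have "\<dots> = fst p * L t x (1, 0) + L t x (0, snd p)" unfolding add scaleR by simp
    finally show ?thesis using U_t[OF assms] U_x(2)[OF assms] by simp
  qed
  then show "((\<lambda>p. U (fst p) (snd p) \<epsilon>) has_derivative (\<lambda>p. fst p * U_t t x + snd p \<bullet> U_x t x)) (at (t, x))"
    by (intro has_derivative_eq_rhs[OF L[OF assms]] ext)
  fix c :: "real \<Rightarrow> real^3" assume c: "continuous_on UNIV c" "range c \<subseteq> \<U>"
  have L_c: "continuous_on UNIV (\<lambda>t. L t (c t) v)" for v
    unfolding L_def using c \<epsilon>
    by (intro continuous_on_compose2[OF cont, of UNIV "\<lambda>t. (t, c t, \<epsilon>)"] continuous_intros) auto
  have in\<U>: "c t \<in> \<U>" for t using c by blast
  show "continuous_on UNIV (\<lambda>t. U_t t (c t))" using L_c[of "(1, 0)"] by (simp add: U_t[OF in\<U>])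
  show "continuous_on UNIV (\<lambda>t. U_x t (c t))"
    unfolding U_x(1)[OF in\<U>] by (intro continuous_intros L_c)
qed

lemma U_t_derivative: "x \<in> \<U> \<Longrightarrow> ((\<lambda>t. U t x \<epsilon>) has_real_derivative U_t t x) (at t)"
proof -
  assume x: "x \<in> \<U>"
  have "((\<lambda>t. (t, x)) has_derivative (\<lambda>h. (h, 0))) (at t)"
    by (auto intro!: derivative_eq_intros)
  from has_derivative_compose[OF this derivative_U(1)[OF x]] show ?thesis
    by (simp add: has_field_derivative_def mult_commute_abs)
qed

lemma U_x_derivative: "x \<in> \<U> \<Longrightarrow> ((\<lambda>x. U t x \<epsilon>) has_derivative (\<lambda>h. h \<bullet> U_x t x)) (at x)"
proof -
  assume x: "x \<in> \<U>"
  have "((\<lambda>x. (t, x)) has_derivative (\<lambda>h. (0, h))) (at x)"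
    by (auto intro!: derivative_eq_intros)
  from has_derivative_compose[OF this derivative_U(1)[OF x]] show ?thesis by simp
qed

lemma K_reg_eq:
  assumes "R3_of_quat (hopf z) \<in> \<U>"
  shows "K_reg U \<epsilon> (z, w, circle_class T t, \<tau>) =
    (norm w)\<^sup>2 / 8 + \<tau> * (norm z)\<^sup>2 - 1 - \<epsilon> * (norm z)\<^sup>2 * U t (R3_of_quat (hopf z)) \<epsilon>"
proof (rule K_reg_circle_class[where U = U and T = T and \<U> = \<U>, OF _ \<epsilon>])
  show "hopf z \<in> quat_of_R3 ` \<U>" using assms quat_of_R3_of_hopf by (metis imageI)
qed (rule periodic)

lemma partial_w_K_reg: "partial_w (K_reg U \<epsilon>) l (z, w, c, \<tau>) = w $ l / 4"
  unfolding partial_w_def K_reg_def prod.case norm_add_axis_sq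
  by (rule DERIV_imp_deriv) (auto intro!: derivative_eq_intros)

lemma partial_\<tau>_K_reg: "partial_\<tau> (K_reg U \<epsilon>) (z, w, c, \<tau>) = (norm z)\<^sup>2"
  unfolding partial_\<tau>_def K_reg_def prod.case
  by (rule DERIV_imp_deriv) (auto intro!: derivative_eq_intros)

lemma rep_circle_class: "\<exists>k. rep (circle_class T t) = t + of_int k * T"
proof -
  have "t \<in> circle_class T t"
    unfolding circle_class_def by (auto intro!: exI[of _ "0::int"])
  then have "rep (circle_class T t) \<in> circle_class T t"
    unfolding rep_def by (rule someI)
  then show ?thesis by (auto simp: circle_class_def)
qed

lemma U_periodic_int: "x \<in> \<U> \<Longrightarrow> U (t + of_int k * T) x \<epsilon> = U t x \<epsilon>"
proof (induction k arbitrary: t rule: int_induct[of _ 0])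
  case (step1 i)
  then show ?case using periodic[of x \<epsilon> "t + of_int i * T"] \<epsilon> by (simp add: algebra_simps)
next
  case (step2 i)
  then show ?case using periodic[of x \<epsilon> "t + of_int (i - 1) * T"] \<epsilon> by (simp add: algebra_simps)
qed simp

text \<open>\<open>partial_t\<close> is evaluated at the chosen representative of the class; this
  moves the result back to \<open>t\<close>.\<close>

lemma U_t_periodic_int: "x \<in> \<U> \<Longrightarrow> U_t (t + of_int k * T) x = U_t t x"
proof -
  assume x: "x \<in> \<U>"
  have "((\<lambda>t. U (t + of_int k * T) x \<epsilon>) has_real_derivative U_t (t + of_int k * T) x) (at t)"
    using U_t_derivative[OF x, of "t + of_int k * T"] by (simp add: DERIV_shift)
  then have "((\<lambda>t. U t x \<epsilon>) has_real_derivative U_t (t + of_int k * T) x) (at t)"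
    by (simp add: U_periodic_int[OF x])
  from DERIV_unique[OF this U_t_derivative[OF x]] show ?thesis .
qed

lemma partial_t_K_reg:
  assumes "R3_of_quat (hopf z) \<in> \<U>"
  shows "partial_t T (K_reg U \<epsilon>) (z, w, circle_class T t, \<tau>) = - \<epsilon> * (norm z)\<^sup>2 * U_t t (R3_of_quat (hopf z))"
proof -
  obtain k where k: "rep (circle_class T t) = t + of_int k * T" using rep_circle_class by blast
  show ?thesis
    unfolding partial_t_def prod.case K_reg_eq[OF assms] k U_t_periodic_int[OF assms, of t k, symmetric]
    by (rule DERIV_imp_deriv) (auto intro!: derivative_eq_intros U_t_derivative[OF assms])
qed

text \<open>The last term is the chain rule through \<open>hopf\<close>, by
  \<open>inner_R3_of_quat_hopf_derivative\<close>. Replacing the representative by \<open>t\<close>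
  is justified only where \<open>hopf\<close> maps into \<U>, which holds near \<open>z\<close>
  because \<U> is open.\<close>

lemma partial_z_K_reg:
  assumes "R3_of_quat (hopf z) \<in> \<U>"
  shows "partial_z (K_reg U \<epsilon>) l (z, w, circle_class T t, \<tau>) =
     2 * \<tau> * z $ l - 2 * \<epsilon> * U t (R3_of_quat (hopf z)) \<epsilon> * z $ l
      + 2 * \<epsilon> * (norm z)\<^sup>2 * (qi \<odot> z \<odot> quat_of_R3 (U_x t (R3_of_quat (hopf z)))) $ l"
proof -
  let ?e = "axis l 1 :: quat" and ?x = "R3_of_quat (hopf z)"
  let ?h = "\<lambda>y. R3_of_quat (hopf (z + y *\<^sub>R ?e))"
  let ?d = "R3_of_quat (qcnj z \<odot> qi \<odot> ?e + qcnj ?e \<odot> qi \<odot> z)"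
  have "((\<lambda>y. z + y *\<^sub>R ?e) has_vector_derivative ?e) (at 0)"
    by (auto intro!: derivative_eq_intros)
  note dz = this
  have "((\<lambda>y. qcnj (z + y *\<^sub>R ?e) \<odot> (qi \<odot> (z + y *\<^sub>R ?e))) has_vector_derivative
      qcnj (z + 0 *\<^sub>R ?e) \<odot> (qi \<odot> ?e + 0 \<odot> (z + 0 *\<^sub>R ?e)) + qcnj ?e \<odot> (qi \<odot> (z + 0 *\<^sub>R ?e))) (at 0)"
    by (intro qmult_derivative_intros dz has_vector_derivative_const)
  then have "((\<lambda>y. hopf (z + y *\<^sub>R ?e)) has_vector_derivative
      qcnj z \<odot> qi \<odot> ?e + qcnj ?e \<odot> qi \<odot> z) (at 0)"
    by (simp add: hopf_def qmult_assoc bounded_bilinear.zero_left[OF bounded_bilinear_qmult])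
  then have dh: "(?h has_vector_derivative ?d) (at 0)"
    by (rule bounded_linear.has_vector_derivative[OF bounded_linear_R3_of_quat])
  then have "isCont ?h 0" by (rule has_vector_derivative_continuous)
  then have "filterlim ?h (nhds (?h 0)) (nhds 0)"
    using tendsto_at_iff_tendsto_nhds[of ?h 0] by (simp only: isCont_def)
  then have "filterlim ?h (nhds ?x) (nhds 0)" by simp
  then have "\<forall>\<^sub>F y in nhds 0. ?h y \<in> \<U>"
    using open_\<U> assms by (rule topological_tendstoD)
  then have ev: "\<forall>\<^sub>F y in nhds 0. K_reg U \<epsilon> (z + y *\<^sub>R ?e, w, circle_class T t, \<tau>) =
     (norm w)\<^sup>2 / 8 + \<tau> * ((norm z)\<^sup>2 + 2 * y * z $ l + y\<^sup>2) - 1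
       - \<epsilon> * ((norm z)\<^sup>2 + 2 * y * z $ l + y\<^sup>2) * U t (?h y) \<epsilon>"
    by eventually_elim (simp only: K_reg_eq norm_add_axis_sq)
  have "((\<lambda>y. U t (?h y) \<epsilon>) has_real_derivative ?d \<bullet> U_x t ?x) (at 0)"
    using has_derivative_compose[OF dh[unfolded has_vector_derivative_def], of "\<lambda>x. U t x \<epsilon>" "\<lambda>h. h \<bullet> U_x t ?x"]
      U_x_derivative[OF assms] by (simp add: has_field_derivative_def mult_commute_abs)
  then have "((\<lambda>y. (norm w)\<^sup>2 / 8 + \<tau> * ((norm z)\<^sup>2 + 2 * y * z $ l + y\<^sup>2) - 1
       - \<epsilon> * ((norm z)\<^sup>2 + 2 * y * z $ l + y\<^sup>2) * U t (?h y) \<epsilon>) has_real_derivative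
      \<tau> * (2 * z $ l) - (\<epsilon> * (norm z)\<^sup>2 * (?d \<bullet> U_x t ?x) + \<epsilon> * (2 * z $ l) * U t ?x \<epsilon>)) (at 0)"
    by (auto intro!: derivative_eq_intros)
  then have "((\<lambda>y. K_reg U \<epsilon> (z + y *\<^sub>R ?e, w, circle_class T t, \<tau>)) has_real_derivative
      \<tau> * (2 * z $ l) - (\<epsilon> * (norm z)\<^sup>2 * (?d \<bullet> U_x t ?x) + \<epsilon> * (2 * z $ l) * U t ?x \<epsilon>)) (at 0)"
    using DERIV_cong_ev[OF refl ev refl] by blast
  moreover have "?d \<bullet> U_x t ?x = - 2 * (qi \<odot> z \<odot> quat_of_R3 (U_x t ?x)) $ l"
    using inner_R3_of_quat_hopf_derivative[of "U_x t ?x" z ?e] by (simp add: inner_commute inner_axis inner_axis' del: qmult_nth)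
  ultimately show ?thesis
    unfolding partial_z_def prod.case by (subst DERIV_imp_deriv) (auto simp: algebra_simps simp del: qmult_nth)
qed

end

section \<open>Regularization of generalized solutions\<close>

lemma continuous_on_removable:
  fixes F :: "real \<Rightarrow> 'a::t2_space"
  assumes isol: "\<And>t. \<not> t islimpt Z" and lim: "\<And>t. t \<in> Z \<Longrightarrow> \<exists>l. F \<midarrow>t\<rightarrow> l"
    and cont: "\<And>t. t \<notin> Z \<Longrightarrow> isCont F t"
  obtains G where "continuous_on UNIV G" "\<And>t. t \<notin> Z \<Longrightarrow> G t = F t"
proof -
  obtain l where l: "\<And>t. t \<in> Z \<Longrightarrow> F \<midarrow>t\<rightarrow> l t" using lim by metis
  define G where "G t = (if t \<in> Z then l t else F t)" for t
  have G: "G t = F t" if "t \<notin> Z" for t using that by (simp add: G_def)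
  have "G \<midarrow>t\<rightarrow> G t" for t
  proof -
    have "\<forall>\<^sub>F s in at t. s \<notin> Z" using isol[of t] by (simp add: islimpt_iff_eventually)
    then have "\<forall>\<^sub>F s in at t. F s = G s" by eventually_elim (simp add: G)
    moreover have "F \<midarrow>t\<rightarrow> G t"
      using l[of t] cont[of t] by (auto simp: G_def isCont_def)
    ultimately show ?thesis by (rule Lim_transform_eventually[rotated])
  qed
  then have "continuous_on UNIV G" by (simp add: continuous_on_def)
  with G that show ?thesis by blast
qed

text \<open>\<open>u\<close> may fail to be differentiable at a collision, where
  \<open>vector_derivative\<close> is an arbitrary choice. Equality persists because both sides
  choose by the same predicate.\<close>

lemma vector_derivative_periodic:
  fixes u :: "real \<Rightarrow> 'a::real_normed_vector"
  assumes per: "\<And>t. u (t + T) = u t"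
  shows "vector_derivative u (at (t + T)) = vector_derivative u (at t)"
proof -
  have shift: "(u has_vector_derivative d) (at a)"
    if d: "(u has_vector_derivative d) (at (a + b))" and b: "\<And>t. u (t + b) = u t" for a b d
  proof -
    have "((\<lambda>t. t + b) has_vector_derivative 1) (at a)"
      by (auto intro!: derivative_eq_intros)
    from vector_diff_chain_at[OF this d] show ?thesis by (simp add: o_def b)
  qed
  have "(u has_vector_derivative d) (at (t + T)) \<longleftrightarrow> (u has_vector_derivative d) (at t)" for d
  proof
    have "u (s + - T) = u s" for s using per[of "s + - T"] by simp
    from shift[of d "t + T" "- T", OF _ this]
    show "(u has_vector_derivative d) (at (t + T))" if "(u has_vector_derivative d) (at t)"
      using that by simp
  qed (rule shift[OF _ per])
  then show ?thesis unfolding vector_derivative_def by simp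
qed

text \<open>\<open>discrete\<close> only isolates the points of the set from one another; since the
  zero set is also closed, it has no limit point anywhere.\<close>

lemma collisions_isolated:
  assumes "generalized_periodic_solution T \<U> U \<epsilon> u"
  shows "\<not> t islimpt {t. u t = 0}"
proof
  assume "t islimpt {t. u t = 0}"
  moreover have "closed {t. u t = 0}"
    using assms continuous_closed_preimage_constant[of UNIV u 0]
    by (auto simp: generalized_periodic_solution_def)
  ultimately have "t \<in> {t. u t = 0}" using closed_limpt by blast
  moreover have "discrete {t. u t = 0}"
    using assms by (simp add: generalized_periodic_solution_def collisions_def)
  ultimately show False
    using \<open>t islimpt _\<close> discreteD isolated_in_islimpt_iff by blast
qed

lemma generalized_solution_regular:
  assumes sol: "generalized_periodic_solution T \<U> U \<epsilon> u" and t: "u t \<noteq> 0"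
  shows "(u has_vector_derivative velocity u t) (at t)"
    "(velocity u has_vector_derivative kepler_field U \<epsilon> t (u t)) (at t)"
proof -
  have "continuous_on UNIV u" using sol by (simp add: generalized_periodic_solution_def)
  then have "open {t. u t \<noteq> 0}" by (intro open_Collect_neq continuous_on_const)
  then obtain d where d: "d > 0" "ball t d \<subseteq> {t. u t \<noteq> 0}"
    using t openE by blast
  have "is_interval (ball t d)" by (simp add: is_interval_ball_real)
  moreover have "ball t d \<subseteq> - collisions u" using d(2) by (auto simp: collisions_def)
  ultimately have I: "smooth_on (ball t d) u"
    "\<forall>s\<in>ball t d. (velocity u has_vector_derivative kepler_field U \<epsilon> s (u s)) (at s)"
    using sol unfolding generalized_periodic_solution_def by (meson open_ball)+
  have tin: "t \<in> ball t d" using d(1) by simp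
  from I(2) tin show "(velocity u has_vector_derivative kepler_field U \<epsilon> t (u t)) (at t)" by blast
  obtain u' where u': "\<And>x. x \<in> ball t d \<Longrightarrow> (u has_derivative u' x) (at x within ball t d)"
    using smooth_onD[OF I(1)] by metis
  have "(u has_derivative u' t) (at t)"
    using u'[OF tin] unfolding at_within_open[OF tin open_ball] .
  then have "u differentiable at t" by (rule differentiableI)
  then show "(u has_vector_derivative velocity u t) (at t)"
    unfolding velocity_def by (simp add: vector_derivative_works)
qed

theorem mainTheorem3:
  fixes T \<epsilon>\<^sub>0 \<epsilon> :: real
    and \<U> :: "(real^3) set"
    and U :: "real \<Rightarrow> real^3 \<Rightarrow> real \<Rightarrow> real"
    and u :: "real \<Rightarrow> real^3"
  assumes "T > 0"
    and "open \<U>" and "0 \<in> \<U>"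
    and "\<epsilon>\<^sub>0 > 0"
    and "smooth_on (UNIV \<times> \<U> \<times> {0..\<epsilon>\<^sub>0}) (\<lambda>(t, x, e). U t x e)"
    and "\<And>t x e. x \<in> \<U> \<Longrightarrow> e \<in> {0..\<epsilon>\<^sub>0} \<Longrightarrow> U (t + T) x e = U t x e"
    and "\<epsilon> \<in> {0..\<epsilon>\<^sub>0}"
    and "generalized_periodic_solution T \<U> U \<epsilon> u"
  shows "\<exists>(X :: real \<Rightarrow> phase) z w c \<tau> (t :: real \<Rightarrow> real) t_inv S g.
      X = (\<lambda>s. (z s, w s, c s, \<tau> s)) \<and>
      hamiltonian_solution T (regularized_domain T \<U>) (K_reg U \<epsilon>) X \<and>
      (\<forall>s. c s = circle_class T (t s)) \<and>
      homeomorphism UNIV UNIV t t_inv \<and>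
      S > 0 \<and> cmod g = 1 \<and>
      (\<forall>s. K_reg U \<epsilon> (X s) = 0 \<and> BL (X s) = 0 \<and>
           X (s + S) = S1_act g (X s) \<and> t (s + S) = t s + T) \<and>
      (\<forall>r. quat_of_R3 (u r) = qcnj (z (t_inv r)) \<odot> qi \<odot> z (t_inv r))"
proof -
  interpret pot: periodic_potential T \<epsilon>\<^sub>0 \<epsilon> \<U> U
    using assms by unfold_locales auto
  note sol = assms(8)
  have cont_u: "continuous_on UNIV u" and u_per: "\<And>t. u (t + T) = u t" and u_in: "\<And>t. u t \<in> \<U>"
    using sol by (auto simp: generalized_periodic_solution_def)
  note isol = collisions_isolated[OF sol]
  note reg = generalized_solution_regular[OF sol]
  have range_u: "range u \<subseteq> \<U>" using u_in by blast
  define f where "f t = \<epsilon> *\<^sub>R pot.U_x t (u t)" for t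
  have cont_U_t: "continuous_on UNIV (\<lambda>t. pot.U_t t (u t))"
    by (rule pot.derivative_U(2)[OF u_in cont_u range_u])
  have cont_f: "continuous_on UNIV f"
    unfolding f_def by (intro continuous_intros pot.derivative_U(3)[OF u_in cont_u range_u])
  have cont_v: "isCont (velocity u) t" if "u t \<noteq> 0" for t
    using reg(2)[OF that] by (rule has_vector_derivative_continuous)
  have cont_u': "isCont u t" for t using cont_u by (simp add: continuous_on_eq_continuous_at)

  obtain n where cont_n: "continuous_on UNIV n" and n: "\<And>t. t \<notin> {t. u t = 0} \<Longrightarrow> n t = u t /\<^sub>R norm (u t)"
  proof (rule continuous_on_removable[OF isol, of "\<lambda>t. u t /\<^sub>R norm (u t)"])
    show "\<exists>l. (\<lambda>t. u t /\<^sub>R norm (u t)) \<midarrow>t\<rightarrow> l" if "t \<in> {t. u t = 0}" for t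
      using sol that by (simp add: generalized_periodic_solution_def collisions_def)
    show "isCont (\<lambda>t. u t /\<^sub>R norm (u t)) t" if "t \<notin> {t. u t = 0}" for t
      using that by (intro continuous_intros cont_u') auto
  qed (rule that)
  obtain h where cont_h: "continuous_on UNIV h"
    and h: "\<And>t. t \<notin> {t. u t = 0} \<Longrightarrow> h t = (norm (velocity u t))\<^sup>2 / 2 - 1 / norm (u t)"
  proof (rule continuous_on_removable[OF isol, of "\<lambda>t. (norm (velocity u t))\<^sup>2 / 2 - 1 / norm (u t)"])
    show "\<exists>l. (\<lambda>t. (norm (velocity u t))\<^sup>2 / 2 - 1 / norm (u t)) \<midarrow>t\<rightarrow> l" if "t \<in> {t. u t = 0}" for t
      using sol that by (simp add: generalized_periodic_solution_def collisions_def)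
    show "isCont (\<lambda>t. (norm (velocity u t))\<^sup>2 / 2 - 1 / norm (u t)) t" if "t \<notin> {t. u t = 0}" for t
      using that by (intro continuous_intros cont_u' cont_v) auto
  qed (rule that)
  interpret orbit: kepler_generalized_orbit u "velocity u" f n h T
  proof
    show "velocity u (t + T) = velocity u t" for t
      unfolding velocity_def by (rule vector_derivative_periodic) (rule u_per)
    show "(velocity u has_vector_derivative - (u t /\<^sub>R norm (u t) ^ 3) + f t) (at t)" if "u t \<noteq> 0" for t
      using reg(2)[OF that] by (simp only: kepler_field_def f_def pot.U_x_def)
  qed (use assms isol cont_u cont_f cont_n cont_h u_per reg n h in simp_all)

  obtain \<theta> s S z z' g where hom: "homeomorphism UNIV UNIV \<theta> s" and S: "S > 0"
    and \<theta>_per: "\<And>x. \<theta> (x + S) = \<theta> x + T"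
    and d\<theta>: "\<And>x. (\<theta> has_vector_derivative orbit.r (\<theta> x)) (at x)"
    and dz: "\<And>x. (z has_vector_derivative z' x) (at x)"
    and dz': "\<And>x. (z' has_vector_derivative
       z x \<odot> ((h (\<theta> x) / 2) *\<^sub>R qone - (1 / 2) *\<^sub>R (quat_of_R3 (u (\<theta> x)) \<odot> quat_of_R3 (f (\<theta> x))))) (at x)"
    and hopf_z: "\<And>x. hopf (z x) = quat_of_R3 (u (\<theta> x))" and norm_z: "\<And>x. (norm (z x))\<^sup>2 = orbit.r (\<theta> x)"
    and bl: "\<And>x. qRe (qcnj (z x) \<odot> qi \<odot> z' x) = 0"
    and norm_z': "\<And>x. (norm (z' x))\<^sup>2 = 1 / 2 + h (\<theta> x) * orbit.r (\<theta> x) / 2"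
    and g: "cmod g = 1" and z_per: "\<And>x. z (x + S) = quat_of_complex g \<odot> z x"
    and z'_per: "\<And>x. z' (x + S) = quat_of_complex g \<odot> z' x"
    by (rule orbit.ks_lift, rule that)

  \<comment> \<open>The value of \<tau> that \<open>K = 0\<close> forces off collisions, because
    \<open>w = 4 z'\<close> gives \<open>|w|^2 / 8 = 1 + h r\<close>. In its derivative the work of
    the perturbing force, common to \<open>\<epsilon> U\<close> and \<open>h\<close>,
    cancels.\<close>
  define k where "k t = \<epsilon> * U t (u t) \<epsilon> - h t" for t
  have dU: "((\<lambda>t. U t (u t) \<epsilon>) has_vector_derivative pot.U_t t (u t) + velocity u t \<bullet> pot.U_x t (u t)) (at t)"
    if "u t \<noteq> 0" for t
  proof -
    have "((\<lambda>t. (t, u t)) has_derivative (\<lambda>y. (y, y *\<^sub>R velocity u t))) (at t)"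
      using reg(1)[OF that] unfolding has_vector_derivative_def by (intro has_derivative_Pair has_derivative_ident)
    from has_derivative_compose[OF this pot.derivative_U(1)[OF u_in]]
    show ?thesis by (simp add: has_vector_derivative_def distrib_left)
  qed
  have isCont_U: "isCont (\<lambda>t. U t (u t) \<epsilon>) t" for t
  proof -
    have "isCont (\<lambda>p. U (fst p) (snd p) \<epsilon>) (t, u t)"
      using has_derivative_continuous[OF pot.derivative_U(1)[OF u_in]] by blast
    moreover have "isCont (\<lambda>t. (t, u t)) t" by (intro continuous_intros cont_u')
    ultimately show ?thesis using isCont_o2[of t "\<lambda>t. (t, u t)" "\<lambda>p. U (fst p) (snd p) \<epsilon>"] by simp
  qed
  have dk: "(k has_vector_derivative \<epsilon> * pot.U_t t (u t)) (at t)" for t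
  proof (rule has_vector_derivative_across_discrete[OF _ _ isol])
    show "continuous_on UNIV k"
      unfolding k_def using isCont_U cont_h
      by (intro continuous_intros) (auto simp: continuous_on_eq_continuous_at)
    show "continuous_on UNIV (\<lambda>t. \<epsilon> * pot.U_t t (u t))" by (intro continuous_intros cont_U_t)
    fix t assume "t \<notin> {t. u t = 0}"
    then have t: "u t \<noteq> 0" by simp
    have "(k has_vector_derivative \<epsilon> * (pot.U_t t (u t) + velocity u t \<bullet> pot.U_x t (u t)) - f t \<bullet> velocity u t) (at t)"
      unfolding k_def
      by (intro has_vector_derivative_diff has_vector_derivative_mult_right dU[OF t] orbit.deriv_h[OF t])
    then show "(k has_vector_derivative \<epsilon> * pot.U_t t (u t)) (at t)"
      by (simp add: f_def inner_commute distrib_left)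
  qed
  have U_per: "U (t + T) x \<epsilon> = U t x \<epsilon>" if "x \<in> \<U>" for t x
    using assms(6)[OF that assms(7)] .
  have k_per: "k (t + T) = k t" for t
    by (simp add: k_def u_per orbit.h_periodic U_per[OF u_in])

  \<comment> \<open>The term \<open>|w|^2 / 8\<close> of the Hamiltonian makes the first equation
    \<open>z' = w / 4\<close>.\<close>
  define w where "w x = 4 *\<^sub>R z' x" for x
  define \<tau> where "\<tau> x = k (\<theta> x)" for x
  define X :: "real \<Rightarrow> phase" where "X x = (z x, w x, circle_class T (\<theta> x), \<tau> x)" for x
  have R3_hopf: "R3_of_quat (hopf (z x)) = u (\<theta> x)" for x by (simp add: hopf_z)
  then have R3_in: "R3_of_quat (hopf (z x)) \<in> \<U>" for x using u_in by simp
  have comp: "((\<lambda>x. F x $ l) has_real_derivative d $ l) (at x)"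
    if "(F has_vector_derivative d) (at x)" for F :: "real \<Rightarrow> quat" and d l x
    using bounded_linear.has_vector_derivative[OF bounded_linear_vec_nth that]
    by (simp add: has_real_derivative_iff_has_vector_derivative)

  have ham: "hamiltonian_solution T (regularized_domain T \<U>) (K_reg U \<epsilon>) X"
    unfolding hamiltonian_solution_def
  proof (intro conjI allI exI)
    show "X x \<in> regularized_domain T \<U>" for x
      using u_in by (auto simp: X_def regularized_domain_def hopf_z circle_def)
    show "X = (\<lambda>x. (z x, w x, circle_class T (\<theta> x), \<tau> x))" by (rule ext) (rule X_def)
    show "((\<lambda>r. z r $ l) has_real_derivative partial_w (K_reg U \<epsilon>) l (X x)) (at x)" for l x
      using comp[OF dz, of l x] by (simp add: X_def pot.partial_w_K_reg w_def)
    show "((\<lambda>r. w r $ l) has_real_derivative - partial_z (K_reg U \<epsilon>) l (X x)) (at x)" for l x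
    proof -
      let ?q = "qi \<odot> z x \<odot> quat_of_R3 (pot.U_x (\<theta> x) (u (\<theta> x)))"
      let ?d = "z x \<odot> ((h (\<theta> x) / 2) *\<^sub>R qone - (1 / 2) *\<^sub>R (quat_of_R3 (u (\<theta> x)) \<odot> quat_of_R3 (f (\<theta> x))))"
      have "z x \<odot> (quat_of_R3 (u (\<theta> x)) \<odot> quat_of_R3 (f (\<theta> x))) = (\<epsilon> * (norm (z x))\<^sup>2) *\<^sub>R ?q"
        unfolding hopf_z[symmetric] qmult_assoc[symmetric] qmult_hopf
        by (simp add: f_def quat_linear_simps)
      then have D: "?d = (h (\<theta> x) / 2) *\<^sub>R z x - (1 / 2 * (\<epsilon> * (norm (z x))\<^sup>2)) *\<^sub>R ?q"
        by (simp add: quat_linear_simps)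
      have H: "h (\<theta> x) = \<epsilon> * U (\<theta> x) (u (\<theta> x)) \<epsilon> - \<tau> x" by (simp add: \<tau>_def k_def)
      have "(4 *\<^sub>R ?d) $ l = - partial_z (K_reg U \<epsilon>) l (X x)"
        unfolding X_def pot.partial_z_K_reg[OF R3_in] R3_hopf D unfolding H
        by (simp add: algebra_simps diff_divide_distrib del: qmult_nth)
      moreover have "(w has_vector_derivative 4 *\<^sub>R ?d) (at x)"
        unfolding w_def
        by (rule bounded_linear.has_vector_derivative[OF bounded_linear_scaleR_right dz'])
      ultimately show ?thesis using comp by metis
    qed
    show "has_circle_derivative T (\<lambda>x. circle_class T (\<theta> x)) (partial_\<tau> (K_reg U \<epsilon>) (X x)) x" for x
      unfolding has_circle_derivative_def X_def pot.partial_\<tau>_K_reg norm_z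
      using d\<theta>[of x] by (intro exI[of _ \<theta>]) (simp add: has_real_derivative_iff_has_vector_derivative)
    show "(\<tau> has_real_derivative - partial_t T (K_reg U \<epsilon>) (X x)) (at x)" for x
      unfolding X_def pot.partial_t_K_reg[OF R3_in] R3_hopf norm_z has_real_derivative_iff_has_vector_derivative \<tau>_def
      using vector_diff_chain_at[OF d\<theta> dk, of x] by (simp add: o_def mult_ac)
  qed
  have K0: "K_reg U \<epsilon> (X x) = 0" for x
  proof -
    have "(norm (w x))\<^sup>2 = 16 * (norm (z' x))\<^sup>2" by (simp add: w_def power_mult_distrib)
    then show ?thesis
      unfolding X_def pot.K_reg_eq[OF R3_in] R3_hopf norm_z norm_z'
      by (simp add: \<tau>_def k_def algebra_simps)
  qed
  have BL0: "BL (X x) = 0" for x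
    using bl[of x] by (simp add: BL_def X_def w_def quat_linear_simps qRe_def del: qmult_nth)
  have per: "X (x + S) = S1_act g (X x)" for x
  proof -
    have "circle_class T (\<theta> x + T) = circle_class T (\<theta> x)"
      unfolding circle_class_eq_iff by (intro exI[of _ 1]) simp
    then show ?thesis
      by (simp add: X_def S1_act_def \<theta>_per z_per z'_per w_def \<tau>_def k_per quat_linear_simps)
  qed
  have "quat_of_R3 (u y) = qcnj (z (s y)) \<odot> qi \<odot> z (s y)" for y
    using hopf_z[of "s y"] homeomorphism_apply2[OF hom] by (simp add: hopf_def)
  then show ?thesis
    using ham hom S g K0 BL0 per \<theta>_per
    by (intro exI[of _ X] exI[of _ z] exI[of _ w] exI[of _ "\<lambda>x. circle_class T (\<theta> x)"] exI[of _ \<tau>] exI[of _ \<theta>]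
        exI[of _ s] exI[of _ S] exI[of _ g]) (auto simp: X_def[abs_def])
qed

end
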